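(* Let $n,m\ge1$. For any standard Young tableau $T$ of shape $\lambda$ with $|\lambda|=n$, the probability that a shelf shuffle with $m$ shelves of $n$ cards produces a permutation whose RSK recording tableau is $T$ equals \[ \frac{1}{2^n}S_\lambda\left(\tfrac1m,\dots,\tfrac1m\right), \] where $S_\lambda$ is evaluated in $m$ variables all equal to $1/m$. Consequently the probability that the produced permutation has RSK shape $\lambda$ equals $\frac{f_\lambda}{2^n}S_\lambda\left(\frac1m,\dots,\frac1m\right)$, where $f_\lambda$ is the number of standard Young tableaux of shape $\lambda$.
   Context: Shelf shuffle with $m$ shelves of a deck of $n$ cards, initially in order $1,\dots,n$ from top to bottom: each card independently gets a label uniform in $\{1,\dots,2m\}$; the new deck consists, from top to bottom, of the packets of cards with labels $1,2,\dots,2m$, the packet with label $j$ in increasing order if $j$ odd and decreasing order if $j$ even; the result is the permutation $w$ with $w(i)$ the card in position $i$ from the top. The Robinson–Schensted–Knuth (RSK) bijection sends $w\in S_n$ to a pair $(P(w),Q(w))$ of standard Young tableaux of the same shape; $Q(w)$ is the recording tableau. For variables $y=(y_1,y_2,\dots)$ define $q_r(y)$ by $\sum_{r\ge0}q_rt^r=\prod_{i}\frac{1+y_it}{1-y_it}$ and $q_{-r}=0$ for $r>0$; for a partition $\lambda=(\lambda_1,\lambda_2,\dots,\lambda_\ell)$, $S_\lambda(y)=\det(q_{\lambda_i-i+j}(y))_{1\le i,j\le \ell}$.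
   Formalization: The recording tableau claim is proved for the inverse of the produced permutation w; for w itself it fails (n=3, m=1: the two tableaux of shape (2,1) have probabilities 1/2 and 0, the formula gives 1/4 each). The shape claim is proved for w as stated. *)

theory Defs
  imports
    "HOL-Probability.Product_PMF"
    "HOL-Computational_Algebra.Formal_Power_Series"
    "HOL-Combinatorics.Permutations"
    "Jordan_Normal_Form.Determinant"
begin

section \<open>Shelf shuffles\<close>

definition packet :: "nat \<Rightarrow> (nat \<Rightarrow> nat) \<Rightarrow> nat \<Rightarrow> nat list" where
  "packet n lab j =
     (let cs = filter (\<lambda>c. lab c = j) [1..<Suc n] in if odd j then cs else rev cs)"

definition shelf_deck :: "nat \<Rightarrow> nat \<Rightarrow> (nat \<Rightarrow> nat) \<Rightarrow> nat list" where
  "shelf_deck m n lab = concat (map (packet n lab) [1..<Suc (2 * m)])"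

text \<open>Positions and cards are numbered from \<open>1\<close>; outside \<open>{1..n}\<close> the
  permutation is the identity, as \<open>permutes\<close> requires.\<close>

definition shelf_perm :: "nat \<Rightarrow> nat \<Rightarrow> (nat \<Rightarrow> nat) \<Rightarrow> nat \<Rightarrow> nat" where
  "shelf_perm m n lab i = (if i \<in> {1..n} then shelf_deck m n lab ! (i - 1) else i)"

definition shelf_shuffle :: "nat \<Rightarrow> nat \<Rightarrow> (nat \<Rightarrow> nat) pmf" where
  "shelf_shuffle m n =
     map_pmf (shelf_perm m n) (Pi_pmf {1..n} 0 (\<lambda>_. pmf_of_set {1..2 * m}))"

lemma set_shelf_deck:
  assumes "\<And>c. c \<in> {1..n} \<Longrightarrow> lab c \<in> {1..2 * m}"
  shows "set (shelf_deck m n lab) = {1..n}"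
  using assms by (fastforce simp: shelf_deck_def packet_def Let_def)

lemma length_shelf_deck:
  assumes "\<And>c. c \<in> {1..n} \<Longrightarrow> lab c \<in> {1..2 * m}"
  shows "length (shelf_deck m n lab) = n"
proof -
  have len: "length (packet n lab j) = card {c \<in> {1..n}. lab c = j}" for j
  proof -
    have "length (packet n lab j) = length (filter (\<lambda>c. lab c = j) [1..<Suc n])"
      by (simp add: packet_def Let_def)
    also have "\<dots> = card (set (filter (\<lambda>c. lab c = j) [1..<Suc n]))"
      by (rule distinct_card [symmetric]) simp
    also have "set (filter (\<lambda>c. lab c = j) [1..<Suc n]) = {c \<in> {1..n}. lab c = j}"
      by auto
    finally show ?thesis .
  qed
  have "length (shelf_deck m n lab) = (\<Sum>j \<in> {1..2 * m}. card {c \<in> {1..n}. lab c = j})"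
    by (simp add: shelf_deck_def length_concat o_def len interv_sum_list_conv_sum_set_nat
        atLeastLessThanSuc_atLeastAtMost del: upt_Suc)
  also have "\<dots> = card (\<Union>j \<in> {1..2 * m}. {c \<in> {1..n}. lab c = j})"
    by (rule card_UN_disjoint [symmetric]) auto
  also have "(\<Union>j \<in> {1..2 * m}. {c \<in> {1..n}. lab c = j}) = {1..n}"
    using assms by auto
  finally show ?thesis by simp
qed

lemma shelf_perm_permutes:
  assumes "\<And>c. c \<in> {1..n} \<Longrightarrow> lab c \<in> {1..2 * m}"
  shows "shelf_perm m n lab permutes {1..n}"
proof (rule bij_imp_permutes)
  let ?d = "shelf_deck m n lab"
  have "distinct ?d"
    by (rule card_distinct)
      (use length_shelf_deck [OF assms] set_shelf_deck [OF assms] in simp)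
  then have "bij_betw ((!) ?d) {..<n} {1..n}"
    using bij_betw_nth [of ?d "{..<n}" "{1..n}"]
      length_shelf_deck [OF assms] set_shelf_deck [OF assms] by simp
  moreover have "bij_betw (\<lambda>i. i - 1) {1..n} {..<n}"
    by (rule bij_betwI [where g = Suc]) auto
  ultimately have "bij_betw ((!) ?d \<circ> (\<lambda>i. i - 1)) {1..n} {1..n}"
    using bij_betw_trans by blast
  then show "bij_betw (shelf_perm m n lab) {1..n} {1..n}"
    by (rule bij_betw_cong [THEN iffD1, rotated]) (simp add: shelf_perm_def)
qed (auto simp: shelf_perm_def)

section \<open>Partitions and standard Young tableaux\<close>

text \<open>Tableaux are lists of rows, in English notation.\<close>

type_synonym tableau = "nat list list"

definition shape :: "tableau \<Rightarrow> nat list" where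
  "shape T = map length T"

definition is_partition :: "nat list \<Rightarrow> bool" where
  "is_partition lam \<longleftrightarrow> sorted_wrt (\<ge>) lam \<and> (\<forall>a \<in> set lam. 0 < a)"

definition SYT :: "nat list \<Rightarrow> tableau set" where
  "SYT lam = {T. shape T = lam
     \<and> distinct (concat T) \<and> set (concat T) = {1..sum_list lam}
     \<and> (\<forall>r \<in> set T. sorted_wrt (<) r)
     \<and> (\<forall>i j. Suc i < length T \<longrightarrow> j < length (T ! Suc i) \<longrightarrow> T ! i ! j < T ! Suc i ! j)}"

definition f_SYT :: "nat list \<Rightarrow> nat" where
  "f_SYT lam = card (SYT lam)"

section \<open>The Robinson--Schensted--Knuth correspondence on permutations\<close>

text \<open>Insert into a row, also returning the entry that is bumped, if any.\<close>

fun row_insert :: "nat \<Rightarrow> nat list \<Rightarrow> nat list \<times> nat option" where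
  "row_insert x [] = ([x], None)"
| "row_insert x (y # ys) =
     (if x < y then (x # ys, Some y)
      else (case row_insert x ys of (zs, b) \<Rightarrow> (y # zs, b)))"

text \<open>Insert into a tableau, also returning the index of the row that acquires the new cell.\<close>

fun tab_insert :: "nat \<Rightarrow> tableau \<Rightarrow> tableau \<times> nat" where
  "tab_insert x [] = ([[x]], 0)"
| "tab_insert x (r # rs) =
     (case row_insert x r of
        (r', None) \<Rightarrow> (r' # rs, 0)
      | (r', Some y) \<Rightarrow> (case tab_insert y rs of (rs', i) \<Rightarrow> (r' # rs', Suc i)))"

definition add_entry :: "nat \<Rightarrow> nat \<Rightarrow> tableau \<Rightarrow> tableau" where
  "add_entry k i Q = (if i < length Q then Q[i := Q ! i @ [k]] else Q @ [[k]])"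

text \<open>\<open>rsk n w = (P, Q)\<close>, obtained by row-inserting \<open>w 1, \<dots>, w n\<close> in this order.
  With the word \<open>w 1, \<dots>, w n\<close> of a shelf-shuffled deck (\<open>w i\<close> the card in position \<open>i\<close>) the
  recording tableaux of a given shape are not equally likely: for \<open>n = 3\<close> and \<open>m = 1\<close>,
  \<open>[[1, 2], [3]]\<close> has probability \<open>1/2\<close> and \<open>[[1, 3], [2]]\<close> has probability \<open>0\<close>. The formula
  for the recording tableau is about the word whose \<open>c\<close>-th letter is the position of card \<open>c\<close>,
  that is, about the inverse of \<open>w\<close>; the shape is that of \<open>w\<close> itself.\<close>

fun rsk :: "nat \<Rightarrow> (nat \<Rightarrow> nat) \<Rightarrow> tableau \<times> tableau" where
  "rsk 0 w = ([], [])"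
| "rsk (Suc k) w =
     (case rsk k w of (P, Q) \<Rightarrow>
        (case tab_insert (w (Suc k)) P of (P', i) \<Rightarrow> (P', add_entry (Suc k) i Q)))"

definition recording_tableau :: "nat \<Rightarrow> (nat \<Rightarrow> nat) \<Rightarrow> tableau" where
  "recording_tableau n w = snd (rsk n w)"

definition rsk_shape :: "nat \<Rightarrow> (nat \<Rightarrow> nat) \<Rightarrow> nat list" where
  "rsk_shape n w = shape (recording_tableau n w)"

section \<open>The symmetric functions \<open>q\<^sub>r\<close> and \<open>S\<^sub>\<lambda>\<close>\<close>

text \<open>The list \<open>ys\<close> contains the values of the finitely many variables.\<close>

definition q_fun :: "real list \<Rightarrow> int \<Rightarrow> real" where
  "q_fun ys r =
     (if r < 0 then 0
      else fps_nth (\<Prod>y\<leftarrow>ys. (1 + fps_const y * fps_X) / (1 - fps_const y * fps_X)) (nat r))"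

text \<open>Indices are \<open>0\<close>-based here, which leaves \<open>\<lambda>\<^sub>i - i + j\<close> unchanged.\<close>

definition S_fun :: "nat list \<Rightarrow> real list \<Rightarrow> real" where
  "S_fun lam ys =
     Determinant.det (Matrix.mat (length lam) (length lam)
       (\<lambda>(i, j). q_fun ys (int (lam ! i) - int i + int j)))"

end

theory Submission
  imports Defs
begin

text \<open>
  The number of labelings that produce a permutation \<open>w\<close> depends only on the descents of \<open>w\<close>: read
  along the deck, the labels increase weakly, and inside a run of equal labels the cards increase if
  the label is odd and decrease if it is even. The descents of \<open>w\<close> are those of its recording
  tableau \<open>Q(w)\<close>, and they are also those of the insertion tableau of the inverse of \<open>w\<close>. So both
  \<open>Q(w\<inverse>) = T\<close> and \<open>shape w = \<lambda>\<close> are reduced, by the bijectivity of Robinson--Schensted and without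
  its symmetry, to counting standard tableaux of shape \<open>\<lambda>\<close> together with a label word compatible
  with their descents, that is, super-tableaux with \<open>m\<close> odd and \<open>m\<close> even letters.

  This number is computed by a determinant in the manner of Jacobi--Trudi. Removing the
  largest cell of a super-tableau, in the order by letter and then by the row in which that letter
  may be added next, gives a recursion; the determinant satisfies the same recursion by linearity
  in a single row, if in row \<open>r\<close> the generating function contains a factor \<open>1 / (1 - y t)\<close> or
  \<open>1 + y t\<close> for each letter that may already occur in row \<open>r\<close>.
\<close>

section \<open>Row insertion\<close>

text \<open>Symmetry would turn \<open>Q\<close> of the inverse into \<open>P(w)\<close>. It is
  avoided as follows: with \<open>u\<close> the inverse of \<open>w\<close>, fixing
  \<open>Q(u) = T\<close> leaves \<open>P(u)\<close> free among the tableaux of the same shape, and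
  the descents of \<open>w\<close> are the inverse descents of \<open>u\<close>, which
  \<open>P(u)\<close> shows. When only the shape is fixed, \<open>Q(w)\<close> shows the descents
  and \<open>P(w)\<close> is free, whence the factor \<open>f_SYT lam\<close>. On the determinant
  side, adding a whole letter would change all rows at once. Adding it row by row changes one row
  per step, at the price of determinants whose rows use different alphabets. The order of the rows
  is forced: the cells of a horizontal strip are added from left to right, hence from bottom to top,
  those of a vertical strip from top to bottom. The same order gives a row and the next one equal
  alphabets when a cell that is no corner would be removed, so the surplus determinant vanishes just
  as the corresponding tableaux do not exist.\<close>

lemma row_insert_append: "\<forall>y \<in> set r. \<not> x < y \<Longrightarrow> row_insert x r = (r @ [x], None)"
  by (induction r) auto

lemma row_insert_bump:
  "p < length r \<Longrightarrow> x < r ! p \<Longrightarrow> \<forall>j<p. \<not> x < r ! j \<Longrightarrow>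
    row_insert x r = (r[p := x], Some (r ! p))"
proof (induction r arbitrary: p)
  case (Cons a r)
  show ?case
  proof (cases p)
    case (Suc q)
    moreover have "\<forall>j<q. \<not> x < r ! j" "\<not> x < a"
      using Cons.prems(3) Suc by (auto dest: spec [of _ "Suc _"])
    ultimately show ?thesis using Cons by auto
  qed (use Cons.prems in auto)
qed simp

lemma row_insert_cases:
  assumes "sorted_wrt (<) r" "x \<notin> set r"
  obtains (append) "\<forall>y \<in> set r. y < x" "row_insert x r = (r @ [x], None)"
  | (bump) p where "p < length r" "x < r ! p" "\<forall>j<p. r ! j < x" "\<forall>j<length r. p < j \<longrightarrow> r ! p < r ! j"
      "row_insert x r = (r[p := x], Some (r ! p))"
proof (cases "\<exists>p<length r. x < r ! p")
  case True
  define p where "p = (LEAST p. p < length r \<and> x < r ! p)"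
  have p: "p < length r" "x < r ! p"
    using LeastI_ex [OF True[simplified]] by (auto simp: p_def)
  have "r ! j < x" if "j < p" for j
  proof -
    have "\<not> x < r ! j" using that p not_less_Least [of j "\<lambda>p. p < length r \<and> x < r ! p"]
      by (auto simp: p_def)
    moreover have "r ! j \<noteq> x" using assms(2) that p(1) by (metis nth_mem order.strict_trans)
    ultimately show ?thesis by simp
  qed
  then show ?thesis
    using p assms(1) sorted_wrt_nth_less [OF assms(1), of p]
    by (intro bump [of p] row_insert_bump) (auto dest: less_asym)
next
  case False
  then have "\<forall>y \<in> set r. y < x" using assms(2) by (metis in_set_conv_nth linorder_neqE_nat)
  then show ?thesis by (intro append row_insert_append) (auto dest: less_asym)
qed

lemma sorted_row_insert:
  assumes "sorted_wrt (<) r" "x \<notin> set r"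
  shows "sorted_wrt (<) (fst (row_insert x r))"
  using assms
proof (cases rule: row_insert_cases)
  case append
  then show ?thesis using assms by (auto simp: sorted_wrt_append)
next
  case (bump p)
  have "x < r ! j" if "p < j" "j < length r" for j
    using bump(2,4) that order.strict_trans by blast
  then show ?thesis using assms(1) bump
    by (auto simp: sorted_wrt_iff_nth_less nth_list_update)
qed

lemma mset_row_insert:
  "mset (fst (row_insert x r)) + (case snd (row_insert x r) of None \<Rightarrow> {#} | Some y \<Rightarrow> {#y#})
    = add_mset x (mset r)"
  by (induction r) (auto split: prod.splits)

lemma row_insert_SomeD:
  assumes "row_insert x r = (r', Some y)"
  shows "x < y" "y \<in> set r" "length r' = length r"
  using assms by (induction r arbitrary: r') (auto split: if_splits prod.splits)

lemma row_insert_NoneD: "row_insert x r = (r', None) \<Longrightarrow> r' = r @ [x]"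
  by (induction r arbitrary: r') (auto split: if_splits prod.splits)

lemma set_row_insert_Some:
  assumes "row_insert x r = (r', Some y)" "distinct r" "x \<notin> set r"
  shows "set r' = insert x (set r - {y})"
proof -
  have m: "mset r' + {#y#} = add_mset x (mset r)"
    using mset_row_insert [of x r] assms(1) by simp
  then have "set (y # r') = set (x # r)"
    by (intro mset_eq_setD) simp
  then have "insert y (set r') = insert x (set r)" by simp
  moreover have "distinct (y # r')"
    using mset_eq_imp_distinct_iff [of "y # r'" "x # r"] m assms(2,3) by auto
  moreover have "x < y" using row_insert_SomeD [OF assms(1)] by simp
  ultimately show ?thesis by auto
qed

lemma length_row_insert_None: "row_insert x r = (r', None) \<Longrightarrow> length r' = Suc (length r)"
  by (drule row_insert_NoneD) simp

section \<open>Tableaux and Schensted insertion\<close>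

definition dominates :: "nat list \<Rightarrow> nat list \<Rightarrow> bool" where
  "dominates r s \<longleftrightarrow> length s \<le> length r \<and> (\<forall>j<length s. r ! j < s ! j)"

text \<open>The row below the last one counts as empty, so the bottom row needs no separate
  treatment.\<close>

fun head_row :: "tableau \<Rightarrow> nat list" where
  "head_row [] = []"
| "head_row (r # rs) = r"

definition entries :: "tableau \<Rightarrow> nat set" where
  "entries P = set (concat P)"

lemma entries_simps [simp]:
  "entries [] = {}" "entries (r # rs) = set r \<union> entries rs"
  by (auto simp: entries_def)

text \<open>The entries are arbitrary, because the tableaux met during insertion, and their lower
  rows, do not have entries \<open>1, ..., n\<close>. The recursion follows that of
  \<open>tab_insert\<close>; \<open>SYT_iff\<close> leads back to \<open>SYT\<close>.\<close>

fun is_tableau :: "tableau \<Rightarrow> bool" where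
  "is_tableau [] = True"
| "is_tableau (r # rs) \<longleftrightarrow>
     r \<noteq> [] \<and> sorted_wrt (<) r \<and> set r \<inter> entries rs = {} \<and> dominates r (head_row rs) \<and>
     is_tableau rs"

fun row_length :: "tableau \<Rightarrow> nat \<Rightarrow> nat" where
  "row_length [] i = 0"
| "row_length (r # rs) 0 = length r"
| "row_length (r # rs) (Suc i) = row_length rs i"

lemma dominates_Nil [simp]: "dominates r []"
  by (simp add: dominates_def)

lemma row_length_0 [simp]: "row_length P 0 = length (head_row P)"
  by (cases P) auto

lemma head_row_eq_Nil: "is_tableau P \<Longrightarrow> head_row P = [] \<longleftrightarrow> P = []"
  by (cases P) auto

lemma sorted_head_row: "is_tableau P \<Longrightarrow> sorted_wrt (<) (head_row P)"
  by (cases P) auto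

lemma set_head_row: "y \<in> set (head_row P) \<Longrightarrow> y \<in> entries P"
  by (cases P) auto

lemma row_length_antimono: "is_tableau P \<Longrightarrow> row_length P (Suc i) \<le> row_length P i"
proof (induction P arbitrary: i)
  case (Cons r rs)
  then show ?case by (cases i) (auto simp: dominates_def)
qed simp

lemma head_row_tab_insert: "head_row (fst (tab_insert x P)) = fst (row_insert x (head_row P))"
  by (cases P) (auto split: prod.splits option.splits)

lemma mset_tab_insert: "mset (concat (fst (tab_insert x P))) = add_mset x (mset (concat P))"
proof (induction P arbitrary: x)
  case (Cons r rs)
  obtain r' b where rb: "row_insert x r = (r', b)" by fastforce
  show ?case
  proof (cases b)
    case None
    then show ?thesis using rb mset_row_insert [of x r] by simp
  next
    case (Some y)
    then show ?thesis using rb mset_row_insert [of x r] Cons.IH [of y]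
      by (auto split: prod.splits)
  qed
qed simp

lemma entries_tab_insert: "entries (fst (tab_insert x P)) = insert x (entries P)"
  unfolding entries_def using arg_cong [OF mset_tab_insert [of x P], of set_mset]
  by (simp only: set_mset_mset set_mset_add_mset_insert)

lemma row_length_tab_insert:
  "row_length (fst (tab_insert x P)) =
    (row_length P)(snd (tab_insert x P) := Suc (row_length P (snd (tab_insert x P))))"
proof (induction P arbitrary: x)
  case Nil
  have "row_length [[x]] j = ((\<lambda>_. 0)(0 := Suc 0)) j" for j by (cases j) auto
  then show ?case by (auto simp: fun_eq_iff)
next
  case (Cons r rs)
  obtain r' b where rb: "row_insert x r = (r', b)" by fastforce
  show ?case
  proof (cases b)
    case None
    have "row_length (r' # rs) j = ((row_length (r # rs))(0 := Suc (length r))) j" for j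
      using rb None length_row_insert_None [of x r r'] by (cases j) auto
    then show ?thesis using rb None by (simp add: fun_eq_iff)
  next
    case (Some y)
    have l: "length r' = length r" using rb Some row_insert_SomeD(3) by blast
    have "row_length (r' # fst (tab_insert y rs)) j =
       ((row_length (r # rs))(Suc (snd (tab_insert y rs)) := Suc (row_length rs (snd (tab_insert y rs))))) j" for j
      using l Cons.IH [of y] by (cases j) auto
    then have "row_length (r' # fst (tab_insert y rs)) =
       (row_length (r # rs))(Suc (snd (tab_insert y rs)) := Suc (row_length rs (snd (tab_insert y rs))))" ..
    then show ?thesis using rb Some by (simp split: prod.split add: split_beta)
  qed
qed

text \<open>Bumping paths move weakly to the left: as \<open>r ! p < s ! p\<close> whenever column
  \<open>p\<close> exists in \<open>s\<close>, the entry bumped from column \<open>p\<close> lands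
  in a column \<open>q \<le> p\<close>. Above it stands \<open>x\<close> if \<open>q = p\<close>,
  and an entry of \<open>r\<close> to the left of \<open>r ! p\<close> otherwise.\<close>

lemma dominates_bump:
  assumes "sorted_wrt (<) r" "sorted_wrt (<) s" "dominates r s" "r ! p \<notin> set s"
    and p: "p < length r" "x < r ! p" "\<forall>j<p. r ! j < x"
  shows "dominates (r[p := x]) (fst (row_insert (r ! p) s))"
  using assms(2,4)
proof (cases rule: row_insert_cases)
  case append
  have "length s \<le> p"
  proof (rule ccontr)
    assume "\<not> length s \<le> p"
    then have "r ! p < s ! p" "s ! p < r ! p"
      using assms(3) append(1) by (auto simp: dominates_def)
    then show False by simp
  qed
  moreover have "r ! length s < r ! p" if "length s < p"
    using that assms(1) p(1) by (simp add: sorted_wrt_nth_less)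
  ultimately show ?thesis using assms(3) p append(2)
    by (auto simp: dominates_def nth_append nth_list_update less_Suc_eq)
next
  case (bump q)
  have "q \<le> p"
  proof (rule ccontr)
    assume "\<not> q \<le> p"
    then have "s ! p < r ! p" "p < length s" using bump by auto
    then show False using assms(3) by (auto simp: dominates_def)
  qed
  moreover have "r ! q < r ! p" if "q < p" using that assms(1) p(1) by (simp add: sorted_wrt_nth_less)
  ultimately show ?thesis using assms(3) p bump
    by (auto simp: dominates_def nth_list_update)
qed

lemma is_tableau_tab_insert:
  "is_tableau P \<Longrightarrow> x \<notin> entries P \<Longrightarrow>
    is_tableau (fst (tab_insert x P))"
proof (induction P arbitrary: x)
  case (Cons r rs)
  have sr: "sorted_wrt (<) r" "x \<notin> set r" using Cons.prems by auto
  then show ?case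
  proof (cases rule: row_insert_cases)
    case append
    then show ?thesis using Cons.prems
      by (auto simp: sorted_wrt_append dominates_def nth_append)
  next
    case (bump p)
    have y: "r ! p \<notin> entries rs" using Cons.prems(1) nth_mem [OF bump(1)] by auto
    have "dominates (r[p := x]) (head_row (fst (tab_insert (r ! p) rs)))"
      unfolding head_row_tab_insert
      using Cons.prems sr bump y by (intro dominates_bump) (auto intro: sorted_head_row dest: set_head_row)
    moreover have "is_tableau (fst (tab_insert (r ! p) rs))" using Cons y by auto
    moreover have "sorted_wrt (<) (r[p := x])" using sorted_row_insert [OF sr] bump by simp
    moreover have "set (r[p := x]) \<inter> entries (fst (tab_insert (r ! p) rs)) = {}"
      using set_row_insert_Some [OF bump(5) _ sr(2)] sr Cons.prems
      by (auto simp: entries_tab_insert strict_sorted_iff)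
    ultimately show ?thesis using bump Cons.prems(1)
      by (auto simp: split_beta simp del: entries_simps(2))
  qed
qed simp

section \<open>Reversibility of insertion\<close>

lemma tab_insert_inj:
  assumes "is_tableau P" "x \<notin> entries P"
    and "is_tableau P2" "x2 \<notin> entries P2"
    and "tab_insert x P = tab_insert x2 P2"
  shows "x = x2 \<and> P = P2"
  using assms
proof (induction P arbitrary: x x2 P2)
  case Nil
  show ?case
  proof (cases P2)
    case (Cons r rs)
    then show ?thesis using Nil.prems row_insert_NoneD [of x2 r "[x]"]
      by (auto split: prod.splits option.splits)
  qed (use Nil in auto)
next
  case (Cons r rs)
  have sr: "sorted_wrt (<) r" "x \<notin> set r" using Cons.prems by auto
  show ?case
  proof (cases P2)
    case Nil
    then show ?thesis using Cons.prems row_insert_NoneD [of x r "[x2]"]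
      by (auto split: prod.splits option.splits)
  next
    case P2: (Cons r2 rs2)
    have sr2: "sorted_wrt (<) r2" "x2 \<notin> set r2" using Cons.prems P2 by auto
    show ?thesis using sr
    proof (cases rule: row_insert_cases)
      case append
      then have "row_insert x2 r2 = (r @ [x], None)" "rs2 = rs"
        using Cons.prems(5) P2 by (auto split: prod.splits option.splits)
      then show ?thesis using row_insert_NoneD P2 by force
    next
      case b: (bump p)
      obtain q where b2: "q < length r2" "x2 < r2 ! q" "\<forall>j<q. r2 ! j < x2"
         "\<forall>j<length r2. q < j \<longrightarrow> r2 ! q < r2 ! j" "row_insert x2 r2 = (r2[q := x2], Some (r2 ! q))"
        using sr2
      proof (cases rule: row_insert_cases)
        case append
        then show ?thesis using Cons.prems(5) P2 b by (auto split: prod.splits)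
      next
        case (bump q)
        then show ?thesis by (intro that)
      qed
      have eq: "r[p := x] = r2[q := x2]" "tab_insert (r ! p) rs = tab_insert (r2 ! q) rs2"
        using Cons.prems(5) P2 b b2 by (auto split: prod.splits)
      have "r ! p \<notin> entries rs" "r2 ! q \<notin> entries rs2"
        using Cons.prems P2 nth_mem [OF b(1)] nth_mem [OF b2(1)] by auto
      then have IH: "r ! p = r2 ! q" "rs = rs2"
        using Cons.IH [of "r ! p" rs2 "r2 ! q"] Cons.prems(1,3) P2 eq(2) by auto
      have len: "length r = length r2" using arg_cong [OF eq(1), of length] by simp
      have "p = q"
      proof (rule ccontr)
        assume "p \<noteq> q"
        moreover have "r[p := x] ! q = x2" "r2[q := x2] ! p = x" using eq b(1) b2(1) len by (metis nth_list_update_eq)+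
        ultimately have "r ! q = x2" "r2 ! p = x" by auto
        \<comment> \<open>If \<open>p < q\<close>, then
          \<open>r ! p < r ! q = x2 < r2 ! q = r ! p\<close>; the case \<open>q < p\<close> is
          symmetric.\<close>
        then show False using \<open>p \<noteq> q\<close> b b2 len IH by (metis less_asym linorder_neqE_nat)
      qed
      then have "x = x2" using eq(1) b(1) b2(1) by (metis nth_list_update_eq)
      moreover have "r = r2" using eq(1) \<open>p = q\<close> IH(1) by (metis list_update_id list_update_overwrite)
      ultimately show ?thesis using IH P2 by simp
    qed
  qed
qed

text \<open>Reverse bumping, starting at the corner of row \<open>i\<close>: its last entry is
  removed, and in each row above, the entry coming from below displaces the largest smaller
  one.\<close>

lemma tab_insert_surj:
  assumes "is_tableau P'" "row_length P' (Suc i) < row_length P' i"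
  obtains x P where "is_tableau P" "x \<notin> entries P" "tab_insert x P = (P', i)"
proof -
  have "\<exists>x P. is_tableau P \<and> x \<notin> entries P \<and> tab_insert x P = (P', i)" using assms
  proof (induction P' arbitrary: i)
    case (Cons r' rs')
    show ?case
    proof (cases i)
      case 0
      have ne: "r' \<noteq> []" and srt: "sorted_wrt (<) r'" using Cons.prems by auto
      define x r where "x = last r'" and "r = butlast r'"
      have r': "r' = r @ [x]" using ne by (simp add: x_def r_def)
      have ri: "row_insert x r = (r', None)"
        unfolding r' using srt r' by (intro row_insert_append) (auto simp: sorted_wrt_append dest: less_asym)
      show ?thesis
      \<comment> \<open>A row that becomes empty has to disappear, since \<open>is_tableau\<close>
        admits no empty rows.\<close>
      proof (cases "r = []")
        case True
        then have "rs' = []" using Cons.prems 0 r' by (cases rs') auto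
        then show ?thesis using True 0 r' by (intro exI [of _ x] exI [of _ "[]"]) auto
      next
        case False
        have "dominates r (head_row rs')" using Cons.prems 0 r'
          by (auto simp: dominates_def nth_append split: if_splits)
        then show ?thesis using False Cons.prems srt ri 0 r'
          by (intro exI [of _ x] exI [of _ "r # rs'"]) (auto simp: sorted_wrt_append)
      qed
    next
      case (Suc k)
      have "\<exists>y rs. is_tableau rs \<and> y \<notin> entries rs \<and> tab_insert y rs = (rs', k)"
        using Cons.prems Suc by (intro Cons.IH) auto
      then obtain y rs where rs: "is_tableau rs" "tab_insert y rs = (rs', k)" and yn: "y \<notin> entries rs"
        by blast
      have srt: "sorted_wrt (<) r'" using Cons.prems by auto
      have ers: "entries rs' = insert y (entries rs)" using entries_tab_insert [of y rs] rs by simp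
      have yr: "y \<notin> set r'" using ers Cons.prems(1) by auto
      have hd': "head_row rs' = fst (row_insert y (head_row rs))"
        using head_row_tab_insert [of y rs] rs by simp
      have shd: "sorted_wrt (<) (head_row rs)" "y \<notin> set (head_row rs)"
        using rs sorted_head_row yn set_head_row by blast+
      have dom: "dominates r' (head_row rs')" using Cons.prems by auto
      \<comment> \<open>\<open>q\<close> is the column of \<open>y\<close> in the top row of
        \<open>rs'\<close>. The entry of \<open>r'\<close> above it is smaller than
        \<open>y\<close>, so there is a place to which \<open>y\<close> can move up.\<close>
      obtain q where q: "q \<le> length (head_row rs)" "q < length (head_row rs')" "head_row rs' ! q = y"
        "\<forall>j<length (head_row rs). j \<noteq> q \<longrightarrow> head_row rs' ! j = head_row rs ! j"
        "q < length (head_row rs) \<longrightarrow> y < head_row rs ! q" "length (head_row rs) \<le> length (head_row rs')"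
        using shd
      proof (cases rule: row_insert_cases)
        case append
        then show ?thesis using hd' by (intro that [of "length (head_row rs)"]) (auto simp: nth_append)
      next
        case (bump p)
        then show ?thesis using hd' by (intro that [of p]) (auto)
      qed
      have sorted': "sorted_wrt (<) (head_row rs')"
        using hd' sorted_row_insert [OF shd] by simp
      have qr: "q < length r'" "r' ! q < y" using dom q by (auto simp: dominates_def)
      \<comment> \<open>The last entry smaller than \<open>y\<close> is the only one whose insertion
        into the restored row bumps \<open>y\<close>.\<close>
      define p where "p = (GREATEST p. p < length r' \<and> r' ! p < y)"
      have p: "p < length r' \<and> r' ! p < y" unfolding p_def
        by (rule GreatestI_nat [where b = "length r'" and k = q]) (use qr in auto)
      have pg: "j \<le> p" if "j < length r'" "r' ! j < y" for j
        unfolding p_def by (rule Greatest_le_nat [where b = "length r'"]) (use that in auto)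
      have above: "y < r' ! j" if "j < length r'" "p < j" for j
        using pg [of j] that yr by (metis linorder_neqE_nat nth_mem not_le)
      have below: "r' ! j < r' ! p" if "j < p" for j
        using that p srt by (simp add: sorted_wrt_nth_less)
      define x r where "x = r' ! p" and "r = r'[p := y]"
      have lr: "length r = length r'" "r ! p = y" using p by (auto simp: r_def)
      have "row_insert x r = (r[p := x], Some (r ! p))"
        using p below lr by (intro row_insert_bump) (auto simp: r_def x_def dest: less_asym)
      then have ri: "row_insert x r = (r', Some y)" using lr by (simp add: r_def x_def)
      have sr: "sorted_wrt (<) r" unfolding sorted_wrt_iff_nth_less
      proof (intro allI impI)
        fix a b assume ab: "a < b" "b < length r"
        then have "r' ! a < r' ! b" using srt lr by (simp add: sorted_wrt_nth_less)
        then show "r ! a < r ! b" using ab above [of b] below [of a] p lr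
          by (auto simp: r_def nth_list_update)
      qed
      have "dominates r (head_row rs)" unfolding dominates_def
      proof (intro conjI allI impI)
        show "length (head_row rs) \<le> length r" using dom lr q(6) by (auto simp: dominates_def)
        fix j assume j: "j < length (head_row rs)"
        have r'j: "r' ! j < head_row rs' ! j" using dom j q(6) by (auto simp: dominates_def)
        have le: "head_row rs' ! j \<le> head_row rs ! j" using q j by (cases "j = q") auto
        show "r ! j < head_row rs ! j"
        proof (cases "j = p")
          case True
          \<comment> \<open>If \<open>q = p\<close>, this is the entry that \<open>y\<close> bumped;
            if \<open>q < p\<close>, column \<open>p\<close> was left unchanged and lies to the
            right of \<open>y\<close>.\<close>
          have "y < head_row rs ! p"
          proof (cases "q = p")
            case True
            then show ?thesis using q \<open>j = p\<close> j by auto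
          next
            case False
            then have "q < p" using pg [OF qr] by simp
            then have "head_row rs' ! q < head_row rs' ! p"
              using sorted' j q(6) True by (simp add: sorted_wrt_nth_less)
            then show ?thesis using q j True False by auto
          qed
          then show ?thesis using True lr by simp
        next
          case False
          then show ?thesis using r'j le by (simp add: r_def)
        qed
      qed
      moreover have sr': "set r \<subseteq> insert y (set r' - {x})"
        using set_update_distinct [of r' p y] srt p by (auto simp: r_def x_def strict_sorted_iff)
      ultimately have "is_tableau (r # rs)" using sr rs lr p ers yn Cons.prems(1) by auto
      moreover have "x \<notin> entries (r # rs)" using sr' p yr ers Cons.prems(1) nth_mem [of p r']
        by (auto simp: x_def disjoint_iff)
      moreover have "tab_insert x (r # rs) = (r' # rs', i)" using ri rs Suc by simp
      ultimately show ?thesis by blast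
    qed
  qed simp
  then show ?thesis using that by blast
qed

section \<open>Descents under insertion\<close>

lemma tab_insert_Cons_None:
  "row_insert x r = (r', None) \<Longrightarrow> tab_insert x (r # rs) = (r' # rs, 0)"
  by simp

lemma tab_insert_Cons_Some:
  "row_insert x r = (r', Some y) \<Longrightarrow>
    tab_insert x (r # rs) = (r' # fst (tab_insert y rs), Suc (snd (tab_insert y rs)))"
  by (simp add: split_beta)

text \<open>Row bumping lemma, weak half. All entries up to the column where \<open>x\<close> acts
  are at most \<open>x\<close>, so \<open>x'\<close> acts strictly to the right of it. The bumped
  entries increase again, and the second path ends no lower than the first.\<close>

lemma tab_insert_ascent:
  assumes "is_tableau P" "x \<notin> entries P" "x' \<notin> entries P" "x < x'"
  shows "snd (tab_insert x' (fst (tab_insert x P))) \<le> snd (tab_insert x P)"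
  using assms
proof (induction P arbitrary: x x')
  case (Cons r rs)
  have sr: "sorted_wrt (<) r" "x \<notin> set r" using Cons.prems by auto
  then show ?case
  proof (cases rule: row_insert_cases)
    case append
    then have "row_insert x' (r @ [x]) = ((r @ [x]) @ [x'], None)"
      using Cons.prems(4) by (intro row_insert_append) (fastforce simp: not_less)
    then show ?thesis using append(2) by (simp only: tab_insert_Cons_None fst_conv snd_conv)
  next
    case b: (bump p)
    have s': "sorted_wrt (<) (r[p := x])" "x' \<notin> set (r[p := x])"
      using sorted_row_insert [OF sr] b(5) Cons.prems(3,4) set_update_subset_insert [of r p x] by auto
    then show ?thesis
    proof (cases rule: row_insert_cases)
      case append
      show ?thesis
        by (simp only: tab_insert_Cons_Some [OF b(5)] tab_insert_Cons_None [OF append(2)] fst_conv snd_conv)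
    next
      case b2: (bump q)
      have "p < q"
      proof (rule ccontr)
        assume "\<not> p < q"
        then have "r[p := x] ! q \<le> x" using b(1,3) by (cases "q = p") (auto simp: less_imp_le)
        then show False using b2(2) Cons.prems(4) by simp
      qed
      then have "r ! p < r ! q" and e: "r[p := x] ! q = r ! q" using b b2 by auto
      moreover have "r ! p \<notin> entries rs" "r ! q \<notin> entries rs"
        using Cons.prems(1) nth_mem [OF b(1)] nth_mem [of q r] b2(1)
        by (auto simp: disjoint_iff)
      ultimately show ?thesis using Cons.IH [of "r ! p" "r ! q"] Cons.prems(1)
        by (simp add: tab_insert_Cons_Some [OF b(5)] tab_insert_Cons_Some [OF b2(5)] e del: tab_insert.simps)
    qed
  qed
qed simp

text \<open>Row bumping lemma, strict half. If \<open>x\<close> is appended, the smaller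
  \<open>x'\<close> has to bump something and so goes on to the next row. Otherwise
  \<open>x'\<close> acts weakly to the left of \<open>x\<close>, and the bumped entries decrease
  again.\<close>

lemma tab_insert_descent:
  assumes "is_tableau P" "x \<notin> entries P" "x' \<notin> entries P" "x' < x"
  shows "snd (tab_insert x P) < snd (tab_insert x' (fst (tab_insert x P)))"
  using assms
proof (induction P arbitrary: x x')
  case (Cons r rs)
  have sr: "sorted_wrt (<) r" "x \<notin> set r" using Cons.prems by auto
  then show ?case
  proof (cases rule: row_insert_cases)
    case append
    have "row_insert x' (r @ [x]) \<noteq> (r', None)" for r'
    proof
      assume e: "row_insert x' (r @ [x]) = (r', None)"
      have "sorted_wrt (<) (r @ [x])" "x' \<notin> set (r @ [x])"
        using append sr Cons.prems by (auto simp: sorted_wrt_append)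
      then have "sorted_wrt (<) r'" using e sorted_row_insert by fastforce
      then show False using row_insert_NoneD [OF e] Cons.prems(4) by (simp add: sorted_wrt_append)
    qed
    then obtain r' y where "row_insert x' (r @ [x]) = (r', Some y)"
      by (cases "row_insert x' (r @ [x])") (metis option.exhaust)
    then show ?thesis by (simp only: tab_insert_Cons_None [OF append(2)] tab_insert_Cons_Some fst_conv snd_conv)
  next
    case b: (bump p)
    have s': "sorted_wrt (<) (r[p := x])" "x' \<notin> set (r[p := x])"
      using sorted_row_insert [OF sr] b(5) Cons.prems(3,4) set_update_subset_insert [of r p x] by auto
    then show ?thesis
    proof (cases rule: row_insert_cases)
      case append
      then have "r[p := x] ! p < x'" using b(1) by (metis length_list_update nth_mem)
      then show ?thesis using b Cons.prems(4) by auto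
    next
      case b2: (bump q)
      have qp: "q \<le> p"
      proof (rule ccontr)
        assume "\<not> q \<le> p"
        then have "r[p := x] ! p < x'" using b2(3) by simp
        then show False using b(1) Cons.prems(4) by simp
      qed
      have lt: "r[p := x] ! q < r ! p"
        using qp b b2 sr by (cases "q = p") (auto simp: sorted_wrt_nth_less)
      moreover have "r ! p \<notin> entries rs" "r[p := x] ! q \<notin> entries rs"
        using Cons.prems(1,2) nth_mem [OF b(1)] nth_mem [of q r] b(1) b2(1)
        by (auto simp: nth_list_update disjoint_iff)
      ultimately show ?thesis using Cons.IH [of "r ! p" "r[p := x] ! q"] Cons.prems(1)
        by (simp add: tab_insert_Cons_Some [OF b(5)] tab_insert_Cons_Some [OF b2(5)] del: tab_insert.simps)
    qed
  qed
qed simp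

text \<open>For \<open>b = a + 1\<close>, both present, this says that \<open>a\<close> is a descent
  of the tableau: \<open>b\<close> lies strictly below \<open>a\<close>. Testing \<open>b\<close>
  first makes a shared row count as no descent.\<close>

fun lower_row :: "nat \<Rightarrow> nat \<Rightarrow> tableau \<Rightarrow> bool" where
  "lower_row a b [] = False"
| "lower_row a b (r # rs) = (if b \<in> set r then False else if a \<in> set r then True else lower_row a b rs)"

text \<open>When \<open>a\<close> and \<open>b\<close> are neighbours in value and share a row, no insertion bumps \<open>b\<close>
  without \<open>a\<close> having gone first; so their relative position is decided once both are present.\<close>

lemma lower_row_tab_insert:
  assumes "is_tableau P" "x \<notin> entries P" "a < b"
    and "\<forall>c \<in> insert x (entries P). c \<le> a \<or> b \<le> c"
    and "{a, b} \<subseteq> insert x (entries P)"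
  shows "lower_row a b (fst (tab_insert x P)) \<longleftrightarrow> (if x = a then True else if x = b then False else lower_row a b P)"
  using assms
proof (induction P arbitrary: x)
  case (Cons r rs)
  have sr: "sorted_wrt (<) r" "x \<notin> set r" "distinct r" using Cons.prems(1,2) by (auto simp: strict_sorted_iff)
  have ab: "a < b" by fact
  have mem: "a \<in> insert x (set r) \<or> a \<in> entries rs" "b \<in> insert x (set r) \<or> b \<in> entries rs"
    using Cons.prems(5) by auto
  show ?case
  proof (cases rule: row_insert_cases [OF sr(1,2)])
    case 1
    then show ?thesis
      unfolding tab_insert_Cons_None [OF 1(2)] fst_conv lower_row.simps using ab by auto
  next
    case (2 p)
    define y where "y = r ! p"
    have y: "y \<in> set r" "x < y" "row_insert x r = (r[p := x], Some y)"
      using nth_mem [OF 2(1)] 2(2,5) by (simp_all only: y_def)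
    have st: "set (r[p := x]) = insert x (set r - {y})"
      using set_row_insert_Some [OF y(3) sr(3,2)] .
    have ynr: "y \<notin> entries rs" using Cons.prems(1) y(1) by auto
    have between: "y \<le> z" if zr: "z \<in> set r" and xz: "x < z" for z
    proof -
      obtain j where j: "j < length r" "z = r ! j" using zr unfolding in_set_conv_nth by blast
      show ?thesis
      proof (cases j p rule: linorder_cases)
        case less
        then have "r ! j < x" using 2(3) by simp
        then show ?thesis using j xz by simp
      next
        case greater
        then have "r ! p < r ! j" using 2(4) j by simp
        then show ?thesis using j by (simp add: y_def)
      qed (use j in \<open>simp add: y_def\<close>)
    qed
    have adj: "\<forall>c \<in> insert x (set r). c \<le> a \<or> b \<le> c" "\<forall>c \<in> insert y (entries rs). c \<le> a \<or> b \<le> c"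
      using Cons.prems(4) y(1) by simp_all
    have IH: "lower_row a b (fst (tab_insert y rs)) \<longleftrightarrow>
       (if y = a then True else if y = b then False else lower_row a b rs)"
      if "a \<in> insert y (entries rs)" "b \<in> insert y (entries rs)"
      using Cons.prems(1) that by (intro Cons.IH ynr ab adj(2)) auto
    have dis: "z \<notin> entries rs" if "z \<in> set r" for z using Cons.prems(1) that by auto
    have eq: "fst (tab_insert x (r # rs)) = r[p := x] # fst (tab_insert y rs)"
      by (simp only: tab_insert_Cons_Some [OF y(3)] fst_conv)
    consider "x = a" | "x = b" | "x \<noteq> a" "x \<noteq> b" by blast
    then show ?thesis
    proof cases
      case 1
      \<comment> \<open>No entry lies strictly between \<open>a = x\<close> and \<open>b\<close>, so
        \<open>a\<close> bumps \<open>b\<close> from a row that contains it.\<close>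
      have "y = b" if "b \<in> set r"
      proof -
        have "y \<le> b" using between [OF that] 1 ab by simp
        moreover have "y \<le> a \<or> b \<le> y" using adj(1) y(1) by blast
        ultimately show ?thesis using 1 y(2) by simp
      qed
      then show ?thesis unfolding eq lower_row.simps st using 1 ab by simp
    next
      case 2
      then show ?thesis unfolding eq lower_row.simps st using ab by simp
    next
      case 3
      \<comment> \<open>An \<open>x\<close> that bumps \<open>b\<close> is smaller than
        \<open>b\<close>, hence smaller than its neighbour \<open>a\<close>; but then
        \<open>a\<close>, being in the row, would have been bumped in preference to
        \<open>b\<close>.\<close>
      have "y \<noteq> b" if "a \<in> set r"
      proof
        assume "y = b"
        moreover have "x \<le> a \<or> b \<le> x" using adj(1) by blast
        ultimately have "x < a" using 3 y(2) by simp
        then show False using between [OF that] \<open>y = b\<close> ab by simp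
      qed
      moreover have "a \<in> set r \<longleftrightarrow> a \<notin> entries rs" "b \<in> set r \<longleftrightarrow> b \<notin> entries rs"
        using mem 3 dis by blast+
      moreover have "a \<noteq> b" using ab by simp
      ultimately show ?thesis
        unfolding eq lower_row.simps st using 3 IH y(1) by (smt (verit) Diff_iff insert_iff singletonD)
    qed
  qed
next
  case Nil
  from Nil(5) have "a = x" "b = x" by (auto simp only: entries_simps)
  then show ?case using \<open>a < b\<close> by simp
qed

section \<open>Lattice words and standard Young tableaux\<close>

text \<open>Words are written with the most recent letter first; the letters are the indices of the
  rows to which the entries \<open>1, 2, \<dots>\<close> of a standard tableau are appended.\<close>

fun lattice_word :: "nat list \<Rightarrow> bool" where
  "lattice_word [] = True"
| "lattice_word (i # s) \<longleftrightarrow> lattice_word s \<and> (i = 0 \<or> count_list s i < count_list s (i - 1))"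

fun tableau_of :: "nat list \<Rightarrow> tableau" where
  "tableau_of [] = []"
| "tableau_of (i # s) = add_entry (Suc (length s)) i (tableau_of s)"

section \<open>Adding and removing the largest entry\<close>

lemma add_entry_simps [simp]:
  "add_entry k i [] = [[k]]"
  "add_entry k 0 (r # rs) = (r @ [k]) # rs"
  "add_entry k (Suc i) (r # rs) = r # add_entry k i rs"
  by (auto simp: add_entry_def)

lemma entries_add_entry: "entries (add_entry k i T) = insert k (entries T)"
proof (induction T arbitrary: i)
  case (Cons r rs)
  then show ?case by (cases i) auto
qed simp

lemma row_length_add_entry:
  "i \<le> length T \<Longrightarrow> row_length (add_entry k i T) j = (if j = i then Suc (row_length T i) else row_length T j)"
proof (induction T arbitrary: i j)
  case Nil
  then show ?case by (cases j) auto
next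
  case (Cons r rs)
  then show ?case by (cases i; cases j) auto
qed

lemma row_length_nth: "row_length T i = (if i < length T then length (T ! i) else 0)"
proof (induction T arbitrary: i)
  case (Cons r rs)
  then show ?case by (cases i) auto
qed simp

lemma is_tableau_rows_nonempty: "is_tableau T \<Longrightarrow> r \<in> set T \<Longrightarrow> r \<noteq> []"
  by (induction T) auto

lemma row_length_pos_iff: "is_tableau T \<Longrightarrow> 0 < row_length T i \<longleftrightarrow> i < length T"
  using is_tableau_rows_nonempty [of T] by (auto simp: row_length_nth)

lemma corner_le_length:
  assumes "is_tableau T" "i = 0 \<or> row_length T i < row_length T (i - 1)"
  shows "i \<le> length T"
  using assms row_length_pos_iff [of T "i - 1"] by (cases i) auto

lemma is_tableau_add_entry:
  assumes "is_tableau T" "\<forall>c \<in> entries T. c < k" "i = 0 \<or> row_length T i < row_length T (i - 1)"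
  shows "is_tableau (add_entry k i T)"
  using assms
proof (induction T arbitrary: i)
  case (Cons r rs)
  show ?case
  proof (cases i)
    case 0
    then show ?thesis using Cons.prems by (auto simp: sorted_wrt_append dominates_def nth_append)
  next
    case (Suc j)
    have c: "j = 0 \<or> row_length rs j < row_length rs (j - 1)"
      using Cons.prems(3) Suc by (cases j) auto
    have "is_tableau (add_entry k j rs)" using Cons.prems c by (intro Cons.IH) auto
    moreover have "dominates r (head_row (add_entry k j rs))"
    proof (cases j)
      case 0
      have "length (head_row rs) < length r" using Cons.prems(3) Suc 0 by simp
      moreover have "head_row (add_entry k 0 rs) = head_row rs @ [k]" by (cases rs) auto
      moreover have "r ! length (head_row rs) < k"
        using Cons.prems(2) nth_mem [of "length (head_row rs)" r] calculation(1) by simp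
      moreover have "dominates r (head_row rs)" using Cons.prems(1) by simp
      ultimately show ?thesis using 0 by (auto simp: dominates_def nth_append less_Suc_eq)
    next
      case (Suc l)
      then have "head_row (add_entry k j rs) = head_row rs" using c by (cases rs) auto
      then show ?thesis using Cons.prems(1) by simp
    qed
    moreover have "set r \<inter> entries (add_entry k j rs) = {}"
      using Cons.prems(1,2) by (auto simp: entries_add_entry)
    ultimately show ?thesis using Cons.prems(1) Suc by simp
  qed
qed simp

text \<open>The row that contains \<open>k\<close> reveals \<open>i\<close>. The bounds matter:
  every index from \<open>length T\<close> on creates the same new row.\<close>

lemma add_entry_inj:
  assumes "is_tableau T" "is_tableau T'" "k \<notin> entries T" "k \<notin> entries T'"
    and "i \<le> length T" "i' \<le> length T'" "add_entry k i T = add_entry k i' T'"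
  shows "i = i' \<and> T = T'"
  using assms
proof (induction T arbitrary: i i' T')
  case Nil
  then show ?case by (cases T'; cases i') (auto simp: append_eq_Cons_conv)
next
  case (Cons r rs)
  show ?case
  proof (cases T')
    case Nil
    then show ?thesis using Cons.prems by (cases i) auto
  next
    case (Cons r' rs')
    then show ?thesis using Cons.prems Cons.IH [of rs' "i - 1" "i' - 1"]
      by (cases i; cases i') auto
  qed
qed

text \<open>The largest entry occupies a corner: nothing follows it in its row, and the next row
  cannot reach its column because columns increase.\<close>

lemma add_entry_Max:
  assumes "is_tableau T" "k \<in> entries T" "\<forall>c \<in> entries T. c \<le> k"
  obtains i T' where "is_tableau T'" "k \<notin> entries T'" "i \<le> length T'" "T = add_entry k i T'"
proof -
  have "\<exists>i T'. is_tableau T' \<and> k \<notin> entries T' \<and> i \<le> length T' \<and> T = add_entry k i T'"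
    using assms
  proof (induction T)
    case (Cons r rs)
    have st: "sorted_wrt (<) r" "dominates r (head_row rs)" "is_tableau rs" "r \<noteq> []" using Cons.prems(1) by auto
    show ?case
    proof (cases "k \<in> set r")
      case True
      then obtain a b where r: "r = a @ k # b" by (meson split_list)
      have "b = []" using Cons.prems(3) st(1) r by (cases b) (auto simp: sorted_wrt_append)
      then have r: "r = a @ [k]" using r by simp
      have nk: "k \<notin> entries rs" using Cons.prems(1) True by auto
      have short: "length (head_row rs) \<le> length a"
      proof (rule ccontr)
        assume "\<not> length (head_row rs) \<le> length a"
        then have l: "length a < length (head_row rs)" by simp
        then have "k < head_row rs ! length a" using st(2) r by (auto simp: dominates_def)
        moreover have "head_row rs ! length a \<in> entries rs" using nth_mem [OF l] set_head_row by blast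
        then have "head_row rs ! length a \<le> k" using Cons.prems(3) by simp
        ultimately show False by simp
      qed
      show ?thesis
      proof (cases "a = []")
        case True
        then have "rs = []" using short st(3) head_row_eq_Nil by auto
        then show ?thesis using r True by (intro exI [of _ 0] exI [of _ "[]"]) auto
      next
        case False
        then have "is_tableau (a # rs)"
          using short Cons.prems(1) r by (auto simp: sorted_wrt_append dominates_def nth_append)
        moreover have "k \<notin> set a" using st(1) r by (auto simp: sorted_wrt_append)
        ultimately show ?thesis using r nk by (intro exI [of _ 0] exI [of _ "a # rs"]) auto
      qed
    next
      case False
      then have "\<exists>i T'. is_tableau T' \<and> k \<notin> entries T' \<and> i \<le> length T' \<and> rs = add_entry k i T'"
        using Cons.prems by (intro Cons.IH) auto
      then obtain i T' where T': "is_tableau T'" "k \<notin> entries T'" "i \<le> length T'" "rs = add_entry k i T'"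
        by blast
      have "dominates r (head_row T')"
      proof (cases T')
        case (Cons t ts)
        then show ?thesis using st(2) T'(4)
          by (cases i) (auto simp: dominates_def nth_append split: if_splits)
      qed simp
      then have "is_tableau (r # T')" using Cons.prems(1) T' by (auto simp: entries_add_entry)
      then show ?thesis using T' False by (intro exI [of _ "Suc i"] exI [of _ "r # T'"]) auto
    qed
  qed simp
  then show ?thesis using that by blast
qed

lemma tableau_of_lattice_word:
  assumes "lattice_word s"
  shows "is_tableau (tableau_of s)" "entries (tableau_of s) = {1..length s}"
    "row_length (tableau_of s) = count_list s"
proof -
  have "is_tableau (tableau_of s) \<and> entries (tableau_of s) = {1..length s} \<and>
    row_length (tableau_of s) = count_list s"
    using assms
  proof (induction s)
    case (Cons i s)
    then have IH: "is_tableau (tableau_of s)" "entries (tableau_of s) = {1..length s}"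
      "row_length (tableau_of s) = count_list s" by auto
    have c: "i = 0 \<or> row_length (tableau_of s) i < row_length (tableau_of s) (i - 1)"
      using Cons.prems IH(3) by simp
    have "is_tableau (tableau_of (i # s))"
      using IH c by (auto intro!: is_tableau_add_entry)
    moreover have "row_length (tableau_of (i # s)) j = count_list (i # s) j" for j
      using IH corner_le_length [OF IH(1) c] by (simp add: row_length_add_entry)
    moreover have "entries (tableau_of (i # s)) = {1..length (i # s)}"
      using IH(2) by (auto simp: entries_add_entry)
    ultimately show ?case by blast
  qed (auto simp: fun_eq_iff)
  then show "is_tableau (tableau_of s)" "entries (tableau_of s) = {1..length s}"
    "row_length (tableau_of s) = count_list s" by blast+
qed

lemma lattice_word_antimono: "lattice_word s \<Longrightarrow> count_list s (Suc i) \<le> count_list s i"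
  using row_length_antimono [of "tableau_of s" i] by (simp add: tableau_of_lattice_word)

lemma lattice_word_le_length:
  "lattice_word (i # s) \<Longrightarrow> i \<le> length (tableau_of s)"
  by (rule corner_le_length) (auto simp: tableau_of_lattice_word)

lemma tableau_of_inj:
  "lattice_word s \<Longrightarrow> lattice_word s' \<Longrightarrow> tableau_of s = tableau_of s' \<Longrightarrow> s = s'"
proof (induction s arbitrary: s')
  case Nil
  then show ?case using tableau_of_lattice_word(2) [of s'] by (cases s') auto
next
  case (Cons i s)
  have "{1..length (i # s)} = {1..length s'}"
    using Cons.prems tableau_of_lattice_word(2) by metis
  then have "card {1..length (i # s)} = card {1..length s'}" by (rule arg_cong)
  then obtain i' t where s': "s' = i' # t" "length t = length s" by (cases s') auto
  have "i = i' \<and> tableau_of s = tableau_of t"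
    using Cons.prems s' tableau_of_lattice_word(1,2) [of s] tableau_of_lattice_word(1,2) [of t]
      lattice_word_le_length [of i s] lattice_word_le_length [of i' t]
    by (intro add_entry_inj [where k = "Suc (length s)"]) auto
  then show ?case using Cons s' by auto
qed

lemma tableau_of_surj:
  assumes "is_tableau T" "entries T = {1..n}"
  obtains s where "lattice_word s" "T = tableau_of s" "length s = n"
proof -
  have "\<exists>s. lattice_word s \<and> T = tableau_of s \<and> length s = n" using assms
  proof (induction n arbitrary: T)
    case 0
    then have "T = []" by (cases T) auto
    then show ?case by (intro exI [of _ "[]"]) auto
  next
    case (Suc n)
    obtain i T' where T': "is_tableau T'" "Suc n \<notin> entries T'" "i \<le> length T'" "T = add_entry (Suc n) i T'"
      by (rule add_entry_Max [OF Suc.prems(1), of "Suc n"]) (use Suc.prems(2) in auto)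
    have "insert (Suc n) (entries T') = insert (Suc n) {1..n}"
      using arg_cong [OF T'(4), of entries] Suc.prems(2)
      by (simp add: entries_add_entry atLeastAtMostSuc_conv)
    then have "entries T' = {1..n}" using T'(2) by (subst (asm) insert_ident) auto
    then obtain s where s: "lattice_word s" "T' = tableau_of s" "length s = n"
      using Suc.IH T'(1) by blast
    have "i = 0 \<or> count_list s i < count_list s (i - 1)"
      using row_length_antimono [OF Suc.prems(1), of "i - 1"] T'(3,4) s
      by (cases i) (auto simp: row_length_add_entry tableau_of_lattice_word)
    then show ?case using s T' by (intro exI [of _ "i # s"]) auto
  qed
  then show ?thesis using that by blast
qed

section \<open>Fixed shapes: lattice words and \<open>SYT\<close>\<close>

definition row_size :: "nat list \<Rightarrow> nat \<Rightarrow> nat" where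
  "row_size lam i = (if i < length lam then lam ! i else 0)"

text \<open>The content is a function on all row indices, a partition being padded with zeros by
  \<open>row_size\<close>. Removing a cell is then a function update, even when a row becomes
  empty.\<close>

definition lattice_words :: "(nat \<Rightarrow> nat) \<Rightarrow> nat list set" where
  "lattice_words c = {s. lattice_word s \<and> count_list s = c}"

lemma is_tableau_iff:
  "is_tableau T \<longleftrightarrow> (\<forall>r \<in> set T. r \<noteq> [] \<and> sorted_wrt (<) r) \<and> distinct (concat T) \<and>
    (\<forall>i. Suc i < length T \<longrightarrow> dominates (T ! i) (T ! Suc i))"
proof (induction T)
  case (Cons r rs)
  have "(\<forall>i. Suc i < length (r # rs) \<longrightarrow> dominates ((r # rs) ! i) ((r # rs) ! Suc i)) \<longleftrightarrow>
    dominates r (head_row rs) \<and> (\<forall>i. Suc i < length rs \<longrightarrow> dominates (rs ! i) (rs ! Suc i))"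
    by (cases rs) (auto simp: nth_Cons split: nat.splits)
  moreover have "sorted_wrt (<) r \<Longrightarrow> distinct r" by (simp add: strict_sorted_iff)
  ultimately show ?case using Cons.IH by (auto simp: entries_def)
qed simp

lemma shape_eq_iff:
  assumes "is_tableau T" "\<forall>a \<in> set lam. 0 < a"
  shows "shape T = lam \<longleftrightarrow> row_length T = row_size lam"
proof
  assume e: "row_length T = row_size lam"
  have "i < length T \<longleftrightarrow> i < length lam" for i
    using row_length_pos_iff [OF assms(1), of i] assms(2) nth_mem [of i lam] unfolding e
    by (auto simp: row_size_def split: if_splits)
  then have l: "length T = length lam" by (metis linorder_neqE_nat less_irrefl)
  show "shape T = lam"
    using l fun_cong [OF e] by (auto simp: shape_def row_length_nth row_size_def list_eq_iff_nth_eq) (metis)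
qed (auto simp: shape_def row_length_nth row_size_def fun_eq_iff)

lemma SYT_iff:
  assumes "is_partition lam"
  shows "T \<in> SYT lam \<longleftrightarrow> is_tableau T \<and> entries T = {1..sum_list lam} \<and> row_length T = row_size lam"
proof -
  have pos: "\<forall>a \<in> set lam. 0 < a" using assms by (simp add: is_partition_def)
  have "T \<in> SYT lam \<longleftrightarrow> is_tableau T \<and> entries T = {1..sum_list lam} \<and> shape T = lam"
  proof
    assume T: "T \<in> SYT lam"
    then have sh: "shape T = lam" by (simp add: SYT_def)
    have "length (T ! Suc i) \<le> length (T ! i)" if "Suc i < length T" for i
    proof -
      have "lam ! i \<ge> lam ! Suc i"
        using assms that sh by (auto simp: is_partition_def shape_def intro: sorted_wrt_nth_less)
      then show ?thesis using that sh by (auto simp: shape_def)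
    qed
    moreover have "\<forall>r \<in> set T. r \<noteq> []" using pos sh by (auto simp: shape_def)
    ultimately show "is_tableau T \<and> entries T = {1..sum_list lam} \<and> shape T = lam"
      using T by (auto simp: is_tableau_iff SYT_def entries_def dominates_def)
  next
    assume "is_tableau T \<and> entries T = {1..sum_list lam} \<and> shape T = lam"
    then show "T \<in> SYT lam"
      by (auto simp: is_tableau_iff SYT_def entries_def dominates_def)
  qed
  then show ?thesis using shape_eq_iff [OF _ pos] by blast
qed

lemma length_lattice_word:
  assumes "count_list s = row_size lam"
  shows "length s = sum_list lam"
proof -
  have "set s \<subseteq> {..<length lam}"
  proof
    fix i assume "i \<in> set s"
    then have "count_list s i \<noteq> 0" by (simp add: count_list_0_iff)
    then show "i \<in> {..<length lam}" using assms by (auto simp: row_size_def split: if_splits)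
  qed
  then have "length s = (\<Sum>i<length lam. count_list s i)"
    using sum_count_set [of s "{..<length lam}"] by simp
  then show ?thesis using assms by (simp add: row_size_def sum_list_sum_nth atLeast0LessThan)
qed

lemma bij_betw_tableau_of:
  assumes "is_partition lam"
  shows "bij_betw tableau_of (lattice_words (row_size lam)) (SYT lam)"
proof (rule bij_betwI')
  fix s s' assume "s \<in> lattice_words (row_size lam)" "s' \<in> lattice_words (row_size lam)"
  then show "tableau_of s = tableau_of s' \<longleftrightarrow> s = s'"
    using tableau_of_inj by (auto simp: lattice_words_def)
next
  fix s assume "s \<in> lattice_words (row_size lam)"
  then show "tableau_of s \<in> SYT lam"
    using length_lattice_word [of s lam]
    by (simp add: SYT_iff [OF assms] lattice_words_def tableau_of_lattice_word)
next
  fix T assume "T \<in> SYT lam"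
  then have T: "is_tableau T" "entries T = {1..sum_list lam}" "row_length T = row_size lam"
    by (auto simp: SYT_iff [OF assms])
  then obtain s where "lattice_word s" "T = tableau_of s" using tableau_of_surj by blast
  then show "\<exists>s \<in> lattice_words (row_size lam). T = tableau_of s"
    using T(3) by (auto simp: lattice_words_def tableau_of_lattice_word)
qed

section \<open>The correspondence for words\<close>

text \<open>The recording tableau is kept as the word of the rows that grow, and recovered by
  \<open>tableau_of\<close>. Input and output both have the most recent letter first, so one
  insertion is one \<open>Cons\<close> on each.\<close>

fun rsk_word :: "nat list \<Rightarrow> tableau \<times> nat list" where
  "rsk_word [] = ([], [])"
| "rsk_word (x # xs) =
    (fst (tab_insert x (fst (rsk_word xs))), snd (tab_insert x (fst (rsk_word xs))) # snd (rsk_word xs))"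

lemma length_rsk_word [simp]: "length (snd (rsk_word xs)) = length xs"
  by (induction xs) auto

lemma rsk_eq_rsk_word:
  "rsk n w = (let (P, s) = rsk_word (rev (map w [1..<Suc n])) in (P, tableau_of s))"
  by (induction n) (auto simp: split_beta Let_def)

lemma rsk_word_tableau:
  "distinct xs \<Longrightarrow> is_tableau (fst (rsk_word xs)) \<and> entries (fst (rsk_word xs)) = set xs"
  by (induction xs) (auto simp: entries_tab_insert intro!: is_tableau_tab_insert)

lemma row_length_rsk_word: "row_length (fst (rsk_word xs)) = count_list (snd (rsk_word xs))"
  by (induction xs) (auto simp: row_length_tab_insert fun_eq_iff)

lemma lattice_rsk_word: "distinct xs \<Longrightarrow> lattice_word (snd (rsk_word xs))"
proof (induction xs)
  case (Cons x xs)
  define P i where "P = fst (rsk_word xs)" and "i = snd (tab_insert x P)"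
  have P: "is_tableau P" "entries P = set xs" using Cons.prems rsk_word_tableau [of xs] by (auto simp: P_def)
  have "is_tableau (fst (tab_insert x P))" using P Cons.prems by (auto intro: is_tableau_tab_insert)
  from row_length_antimono [OF this, of "i - 1"] have "i = 0 \<or> row_length P i < row_length P (i - 1)"
    by (cases i) (auto simp: row_length_tab_insert simp flip: i_def)
  then show ?case using Cons by (auto simp: P_def i_def row_length_rsk_word)
qed simp

lemma rsk_word_inj:
  "distinct xs \<Longrightarrow> distinct ys \<Longrightarrow> rsk_word xs = rsk_word ys \<Longrightarrow> xs = ys"
proof (induction xs arbitrary: ys)
  case Nil
  then show ?case by (cases ys) auto
next
  case (Cons x xs)
  have "length ys = length (x # xs)" using arg_cong [OF Cons.prems(3), of "\<lambda>p. length (snd p)"] by simp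
  then obtain y zs where ys: "ys = y # zs" by (cases ys) auto
  have e: "tab_insert x (fst (rsk_word xs)) = tab_insert y (fst (rsk_word zs))" "snd (rsk_word xs) = snd (rsk_word zs)"
    using Cons.prems(3) by (auto simp: ys prod_eq_iff)
  have "x = y \<and> fst (rsk_word xs) = fst (rsk_word zs)"
    using Cons.prems ys e rsk_word_tableau [of xs] rsk_word_tableau [of zs] by (intro tab_insert_inj) auto
  then show ?case using e Cons ys by (auto simp: prod_eq_iff)
qed

lemma rsk_word_surj:
  assumes "lattice_word s" "is_tableau P" "row_length P = count_list s"
  obtains xs where "distinct xs" "rsk_word xs = (P, s)"
proof -
  have "\<exists>xs. distinct xs \<and> rsk_word xs = (P, s)" using assms
  proof (induction s arbitrary: P)
    case Nil
    then have "P = []" using row_length_pos_iff [of P 0] by auto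
    then show ?case by (intro exI [of _ "[]"]) auto
  next
    case (Cons i s)
    have "row_length P (Suc i) < row_length P i"
      using Cons.prems lattice_word_antimono [of s i] by simp
    then obtain x P' where P': "is_tableau P'" "x \<notin> entries P'" "tab_insert x P' = (P, i)"
      using tab_insert_surj [OF Cons.prems(2)] by blast
    have e: "row_length P = (row_length P')(i := Suc (row_length P' i))"
      using row_length_tab_insert [of x P'] P'(3) by simp
    have "row_length P' j = count_list s j" for j
      using fun_cong [OF e, of j] fun_cong [OF Cons.prems(3), of j] by (auto split: if_splits)
    then obtain xs where "distinct xs" "rsk_word xs = (P', s)" using Cons.IH [of P'] Cons.prems P' by auto
    then show ?case using P' rsk_word_tableau [of xs] by (intro exI [of _ "x # xs"]) auto
  qed
  then show ?thesis using that by blast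
qed

text \<open>The two halves of the row bumping lemma, applied to consecutive insertions. Index
  \<open>j\<close> is the later of the two, so both sides speak of a descent in reading
  order.\<close>

lemma rsk_word_descent:
  assumes "distinct xs" "Suc j < length xs"
  shows "snd (rsk_word xs) ! Suc j < snd (rsk_word xs) ! j \<longleftrightarrow> xs ! j < xs ! Suc j"
  using assms
proof (induction xs arbitrary: j)
  case (Cons x' xs)
  show ?case
  proof (cases j)
    case 0
    then obtain x zs where xs: "xs = x # zs" using Cons.prems(2) by (cases xs) auto
    define P where "P = fst (rsk_word zs)"
    have P: "is_tableau P" "x \<notin> entries P" "x' \<notin> entries P" "x \<noteq> x'"
      using Cons.prems(1) rsk_word_tableau [of zs] by (auto simp: P_def xs)
    have "x < x' \<Longrightarrow> snd (tab_insert x' (fst (tab_insert x P))) \<le> snd (tab_insert x P)"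
      "x' < x \<Longrightarrow> snd (tab_insert x P) < snd (tab_insert x' (fst (tab_insert x P)))"
      using tab_insert_ascent [OF P(1-3)] tab_insert_descent [OF P(1-3)] by auto
    moreover have "x < x' \<or> x' < x" using P(4) by auto
    ultimately show ?thesis using 0 by (auto simp: xs simp flip: P_def)
  next
    case (Suc l)
    then show ?thesis using Cons by simp
  qed
qed simp

text \<open>The relative position is decided when the later of the two letters arrives, and every
  further insertion preserves it. As recent letters come first, \<open>i < j\<close> says that the
  smaller letter arrived later, which for consecutive values is an inverse descent of the
  word.\<close>

lemma lower_row_rsk_word:
  assumes "distinct xs" "i < length xs" "j < length xs" "xs ! i < xs ! j"
    and "\<forall>c \<in> set xs. c \<le> xs ! i \<or> xs ! j \<le> c"
  shows "lower_row (xs ! i) (xs ! j) (fst (rsk_word xs)) \<longleftrightarrow> i < j"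
  using assms
proof (induction xs arbitrary: i j)
  case (Cons x xs)
  define P where "P = fst (rsk_word xs)"
  have P: "is_tableau P" "entries P = set xs" using Cons.prems(1) rsk_word_tableau [of xs] by (auto simp: P_def)
  have ne: "i \<noteq> j" using Cons.prems(4) by auto
  let ?a = "(x # xs) ! i" and ?b = "(x # xs) ! j"
  have mem: "?a \<in> set (x # xs)" "?b \<in> set (x # xs)" using Cons.prems(2,3) nth_mem by blast+
  have "lower_row ?a ?b (fst (tab_insert x P)) \<longleftrightarrow>
    (if x = ?a then True else if x = ?b then False else lower_row ?a ?b P)"
    using P Cons.prems(1,4,5) mem by (intro lower_row_tab_insert) auto
  moreover have "x = ?a \<longleftrightarrow> i = 0" "x = ?b \<longleftrightarrow> j = 0"
    using Cons.prems(1-3) nth_eq_iff_index_eq [of "x # xs" 0] by force+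
  moreover have "lower_row ?a ?b P \<longleftrightarrow> i < j" if "i \<noteq> 0" "j \<noteq> 0"
    using Cons.IH [of "i - 1" "j - 1"] Cons.prems that by (auto simp: P_def)
  ultimately show ?case using ne by (auto simp flip: P_def)
qed simp

section \<open>Descents of a standard tableau read from its lattice word\<close>

lemma lower_row_add_entry:
  "k \<noteq> a \<Longrightarrow> k \<noteq> b \<Longrightarrow> lower_row a b (add_entry k i T) = lower_row a b T"
proof (induction T arbitrary: i)
  case (Cons r rs)
  then show ?case by (cases i) auto
qed simp

lemma lower_row_add_entry_add_entry:
  assumes "a \<noteq> b" "a \<notin> entries T" "b \<notin> entries T" "i \<le> length T" "j \<le> length (add_entry a i T)"
  shows "lower_row a b (add_entry b j (add_entry a i T)) \<longleftrightarrow> i < j"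
  using assms
proof (induction T arbitrary: i j)
  case Nil
  then show ?case by (cases j) auto
next
  case (Cons r rs)
  then show ?case
    by (cases i; cases j) (auto simp: entries_add_entry)
qed

text \<open>With the most recent letter first, \<open>s ! j\<close> is the row of the entry
  \<open>length s - j\<close>. Only the insertion of the two neighbouring entries matters, since the
  larger ones are added in other cells.\<close>

lemma lower_row_tableau_of:
  assumes "lattice_word s" "Suc j < length s"
  shows "lower_row (length s - Suc j) (length s - j) (tableau_of s) \<longleftrightarrow> s ! Suc j < s ! j"
  using assms
proof (induction s arbitrary: j)
  case (Cons x s)
  show ?case
  proof (cases j)
    case 0
    then obtain y t where s: "s = y # t" using Cons.prems by (cases s) auto
    have "lower_row (Suc (length t)) (Suc (Suc (length t)))
       (add_entry (Suc (Suc (length t))) x (add_entry (Suc (length t)) y (tableau_of t))) \<longleftrightarrow> y < x"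
      using Cons.prems(1) s lattice_word_le_length [of y t] lattice_word_le_length [of x s]
      by (intro lower_row_add_entry_add_entry) (auto simp: tableau_of_lattice_word)
    then show ?thesis using 0 s by simp
  next
    case (Suc l)
    then show ?thesis using Cons by (simp add: lower_row_add_entry)
  qed
qed simp

section \<open>Counting labelings\<close>

abbreviation labelings :: "nat \<Rightarrow> nat \<Rightarrow> (nat \<Rightarrow> nat) set" where
  "labelings m n \<equiv> PiE_dflt {1..n} 0 (\<lambda>_. {1..2 * m})"

text \<open>The order from top to bottom that a labeling imposes on the cards. The deck becomes the
  sorted list for this order, a condition that can be tested on neighbours.\<close>

definition card_less :: "(nat \<Rightarrow> nat) \<Rightarrow> nat \<Rightarrow> nat \<Rightarrow> bool" where
  "card_less lab c c' \<longleftrightarrow>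
     lab c < lab c' \<or> lab c = lab c' \<and> (if odd (lab c) then c < c' else c' < c)"

text \<open>Decks and their labels are read from the last card to the first; \<open>D j\<close> says that the deck
  has a descent between its entries \<open>j + 1\<close> and \<open>j\<close> from the end.\<close>

definition label_words :: "nat \<Rightarrow> nat \<Rightarrow> (nat \<Rightarrow> bool) \<Rightarrow> nat list set" where
  "label_words m n D = {b. length b = n \<and> set b \<subseteq> {1..2 * m} \<and>
     (\<forall>j. Suc j < n \<longrightarrow> b ! Suc j < b ! j \<or> b ! Suc j = b ! j \<and> (D j \<longleftrightarrow> even (b ! j)))}"

definition word_of :: "nat \<Rightarrow> (nat \<Rightarrow> nat) \<Rightarrow> nat list" where
  "word_of n w = map w (rev [1..<Suc n])"

lemma length_word_of [simp]: "length (word_of n w) = n"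
  by (simp add: word_of_def)

lemma nth_word_of: "j < n \<Longrightarrow> word_of n w ! j = w (n - j)"
  by (simp add: word_of_def rev_nth Suc_diff_Suc del: upt_Suc)

lemma set_word_of [simp]: "set (word_of n w) = w ` {1..n}"
  by (auto simp: word_of_def simp del: upt_Suc)

lemma rsk_eq_word_of: "rsk n w = (fst (rsk_word (word_of n w)), tableau_of (snd (rsk_word (word_of n w))))"
  by (simp add: rsk_eq_rsk_word word_of_def rev_map split_beta Let_def del: upt_Suc)

lemma transp_card_less: "transp (card_less lab)"
proof (rule transpI)
  fix a b c assume "card_less lab a b" "card_less lab b c"
  then show "card_less lab a c" unfolding card_less_def by (cases "odd (lab a)") fastforce+
qed

lemma asym_card_less: "card_less lab c c' \<Longrightarrow> \<not> card_less lab c' c"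
  by (cases "lab c = lab c'") (simp_all add: card_less_def split: if_splits)

lemma sorted_wrt_unique:
  assumes "\<And>x y. R x y \<Longrightarrow> \<not> R y x" "sorted_wrt R xs" "sorted_wrt R ys" "set xs = set ys"
  shows "xs = ys"
  using assms(2-)
proof (induction xs arbitrary: ys)
  case (Cons x xs)
  from Cons.prems(3) obtain y zs where ys: "ys = y # zs" by (cases ys) auto
  have xy: "x = y"
  proof (rule ccontr)
    assume ne: "x \<noteq> y"
    have "y \<in> set (x # xs)" unfolding Cons.prems(3) ys by simp
    then have "R x y" using Cons.prems(1) ne by simp
    moreover have "x \<in> set ys" unfolding Cons.prems(3) [symmetric] by simp
    then have "R y x" using Cons.prems(2) ne by (simp add: ys)
    ultimately show False using assms(1) [of x y] by simp
  qed
  have irrefl: "\<not> R z z" for z using assms(1) [of z z] by (cases "R z z") simp_all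
  have "x \<notin> set xs" "y \<notin> set zs" using Cons.prems(1,2) irrefl unfolding ys sorted_wrt.simps by blast+
  moreover have "insert x (set xs) = insert x (set zs)" using Cons.prems(3) xy by (simp add: ys)
  ultimately have "set xs = set zs" using xy insert_ident by metis
  then have "xs = zs" using Cons.IH [of zs] Cons.prems(1,2) by (simp add: ys)
  then show ?case using xy by (simp add: ys)
qed simp

lemma sorted_packet: "sorted_wrt (card_less lab) (packet n lab j)"
proof -
  have s: "sorted_wrt (<) (filter (\<lambda>c. lab c = j) [1..<Suc n])"
    by (intro sorted_wrt_filter sorted_wrt_upt)
  show ?thesis
    unfolding packet_def Let_def
    using sorted_wrt_mono_rel [OF _ s]
    by (auto simp: sorted_wrt_rev card_less_def simp del: upt_Suc)
qed

lemma packet_label: "c \<in> set (packet n lab j) \<Longrightarrow> lab c = j"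
  by (auto simp: packet_def Let_def split: if_splits)

lemma sorted_shelf_deck: "sorted_wrt (card_less lab) (shelf_deck m n lab)"
proof -
  have "sorted_wrt (card_less lab) (concat (map (packet n lab) [1..<Suc b]))" for b
  proof (induction b)
    case (Suc b)
    have "card_less lab x y"
      if "x \<in> set (concat (map (packet n lab) [1..<Suc b]))" "y \<in> set (packet n lab (Suc b))" for x y
    proof -
      have "lab x < Suc b" using that(1) by (auto simp del: upt_Suc dest: packet_label)
      then show ?thesis using packet_label [OF that(2)] by (simp add: card_less_def)
    qed
    moreover have "[1..<Suc (Suc b)] = [1..<Suc b] @ [Suc b]" by simp
    ultimately show ?case using Suc.IH sorted_packet [of lab n "Suc b"]
      by (auto simp only: map_append concat_append sorted_wrt_append list.map concat.simps append_Nil2)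
  qed simp
  then show ?thesis unfolding shelf_deck_def .
qed

lemma labelingsD: "lab \<in> labelings m n \<Longrightarrow> c \<in> {1..n} \<Longrightarrow> lab c \<in> {1..2 * m}"
  by (auto simp: PiE_dflt_def)

text \<open>Two lists with the same elements that are sorted by an asymmetric relation coincide, and
  by transitivity sortedness is a condition on neighbours.\<close>

lemma rev_shelf_deck_iff:
  assumes "lab \<in> labelings m n" "set xs = {1..n}"
  shows "rev (shelf_deck m n lab) = xs \<longleftrightarrow>
    (\<forall>j. Suc j < length xs \<longrightarrow> card_less lab (xs ! Suc j) (xs ! j))"
proof -
  have set: "set (shelf_deck m n lab) = {1..n}"
    using assms(1) by (intro set_shelf_deck) (rule labelingsD)
  have "rev (shelf_deck m n lab) = xs \<longleftrightarrow> sorted_wrt (card_less lab) (rev xs)"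
  proof
    assume "sorted_wrt (card_less lab) (rev xs)"
    then have "rev xs = shelf_deck m n lab"
      using sorted_shelf_deck set assms(2) asym_card_less
      by (intro sorted_wrt_unique [where R = "card_less lab"]) auto
    then show "rev (shelf_deck m n lab) = xs" by (metis rev_rev_ident)
  qed (use sorted_shelf_deck in auto)
  also have "\<dots> \<longleftrightarrow> (\<forall>j. Suc j < length xs \<longrightarrow> card_less lab (xs ! Suc j) (xs ! j))"
    unfolding sorted_wrt_rev using transp_card_less [of lab]
    by (intro sorted_wrt_iff_nth_Suc_transp) (auto simp: transp_def)
  finally show ?thesis .
qed

text \<open>Reading the labels along \<open>xs\<close> loses nothing, since every card occurs there.
  Neighbouring cards are distinct, so under equal labels the deck descends exactly when the label is
  even.\<close>

lemma card_labelings_deck: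
  assumes "distinct xs" "set xs = {1..n}"
  shows "card {lab \<in> labelings m n. rev (shelf_deck m n lab) = xs} =
    card (label_words m n (\<lambda>j. xs ! j < xs ! Suc j))"
proof (rule bij_betw_same_card)
  have len: "length xs = n" using assms distinct_card by fastforce
  have deck: "lab \<in> labelings m n \<Longrightarrow> rev (shelf_deck m n lab) = xs \<longleftrightarrow>
      (\<forall>j. Suc j < n \<longrightarrow> card_less lab (xs ! Suc j) (xs ! j))" for lab
    using rev_shelf_deck_iff [OF _ assms(2)] len by simp
  have adj: "card_less lab (xs ! Suc j) (xs ! j) \<longleftrightarrow> map lab xs ! Suc j < map lab xs ! j \<or>
     map lab xs ! Suc j = map lab xs ! j \<and> (xs ! j < xs ! Suc j \<longleftrightarrow> even (map lab xs ! j))"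
    if "Suc j < n" for j lab
  proof -
    have "xs ! j \<noteq> xs ! Suc j" using assms(1) that len by (simp add: nth_eq_iff_index_eq)
    then show ?thesis using that len by (auto simp: card_less_def)
  qed
  show "bij_betw (\<lambda>lab. map lab xs) {lab \<in> labelings m n. rev (shelf_deck m n lab) = xs}
     (label_words m n (\<lambda>j. xs ! j < xs ! Suc j))"
  proof (rule bij_betwI')
    fix lab lab'
    assume "lab \<in> {lab \<in> labelings m n. rev (shelf_deck m n lab) = xs}"
      "lab' \<in> {lab \<in> labelings m n. rev (shelf_deck m n lab) = xs}"
    then have L: "\<forall>c. c \<notin> {1..n} \<longrightarrow> lab c = 0 \<and> lab' c = 0" by (auto simp: PiE_dflt_def)
    show "map lab xs = map lab' xs \<longleftrightarrow> lab = lab'"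
    proof
      assume "map lab xs = map lab' xs"
      then have "\<forall>c \<in> {1..n}. lab c = lab' c" using assms(2) by auto
      then show "lab = lab'" using L by (metis ext)
    qed simp
  next
    fix lab assume "lab \<in> {lab \<in> labelings m n. rev (shelf_deck m n lab) = xs}"
    then have L: "lab \<in> labelings m n" and "\<forall>j. Suc j < n \<longrightarrow> card_less lab (xs ! Suc j) (xs ! j)"
      using deck by auto
    moreover have "set (map lab xs) \<subseteq> {1..2 * m}" using L labelingsD [OF L] assms(2) by auto
    ultimately show "map lab xs \<in> label_words m n (\<lambda>j. xs ! j < xs ! Suc j)"
      using adj len by (simp add: label_words_def)
  next
    fix b assume b: "b \<in> label_words m n (\<lambda>j. xs ! j < xs ! Suc j)"
    then have lb: "length b = n" "set b \<subseteq> {1..2 * m}" by (auto simp: label_words_def)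
    \<comment> \<open>The value \<open>0\<close> off the deck is the default value of
      \<open>labelings\<close>.\<close>
    define lab where "lab c = (case map_of (zip xs b) c of None \<Rightarrow> 0 | Some v \<Rightarrow> v)" for c
    have lab: "lab (xs ! j) = b ! j" if "j < n" for j
      using that lb len assms(1) by (simp add: lab_def map_of_zip_nth)
    have map: "map lab xs = b" using lab lb len by (simp add: list_eq_iff_nth_eq)
    have out: "lab c = 0" if "c \<notin> {1..n}" for c
    proof -
      have "map_of (zip xs b) c = None" using that assms(2) lb len by (simp add: map_of_zip_is_None)
      then show ?thesis by (simp add: lab_def)
    qed
    have "lab c \<in> {1..2 * m}" if "c \<in> {1..n}" for c
      using that assms(2) lb(2) map by (metis image_eqI list.set_map subsetD)
    then have L: "lab \<in> labelings m n" using out by (auto simp: PiE_dflt_def)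
    have "rev (shelf_deck m n lab) = xs"
      using b adj map unfolding deck [OF L] by (simp add: label_words_def)
    then show "\<exists>lab \<in> {lab \<in> labelings m n. rev (shelf_deck m n lab) = xs}. b = map lab xs"
      using L map by auto
  qed
qed

section \<open>From decks to permutations\<close>

lemma word_of_shelf_perm:
  assumes "lab \<in> labelings m n"
  shows "word_of n (shelf_perm m n lab) = rev (shelf_deck m n lab)"
proof -
  have "length (shelf_deck m n lab) = n" using assms by (intro length_shelf_deck) (rule labelingsD)
  then show ?thesis
    by (auto simp: list_eq_iff_nth_eq nth_word_of shelf_perm_def rev_nth)
qed

lemma permutes_eqI_word_of:
  assumes "w permutes {1..n}" "w' permutes {1..n}" "word_of n w = word_of n w'"
  shows "w = w'"
proof
  fix i
  show "w i = w' i"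
  proof (cases "i \<in> {1..n}")
    case True
    then have "w (n - (n - i)) = w' (n - (n - i))"
      using nth_word_of [of "n - i" n w] nth_word_of [of "n - i" n w'] assms(3) by simp
    then show ?thesis using True by simp
  next
    case False
    then show ?thesis using assms by (simp add: permutes_not_in)
  qed
qed

lemma word_of_permutes:
  assumes "w permutes {1..n}"
  shows "distinct (word_of n w)" "set (word_of n w) = {1..n}"
  using permutes_image [OF assms] permutes_inj_on [OF assms, of "{1..n}"]
  by (auto simp: word_of_def distinct_map atLeastLessThanSuc_atLeastAtMost simp del: upt_Suc)

lemma word_of_surj:
  assumes "distinct xs" "set xs = {1..n}"
  obtains w where "w permutes {1..n}" "word_of n w = xs"
proof -
  have len: "length xs = n" using assms distinct_card by fastforce
  define w where "w i = (if i \<in> {1..n} then xs ! (n - i) else i)" for i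
  have eq: "word_of n w = xs" using len by (auto simp: list_eq_iff_nth_eq nth_word_of w_def)
  then have "w ` {1..n} = {1..n}" using assms(2) set_word_of by metis
  then have "bij_betw w {1..n} {1..n}" by (simp add: bij_betw_def eq_card_imp_inj_on)
  then have "w permutes {1..n}" by (rule bij_imp_permutes) (auto simp: w_def)
  then show ?thesis using eq that by blast
qed

lemma card_labelings_shelf_perm:
  assumes "\<forall>w \<in> A. w permutes {1..n}"
  shows "card {lab \<in> labelings m n. shelf_perm m n lab \<in> A} =
    (\<Sum>w \<in> A. card (label_words m n (\<lambda>j. word_of n w ! j < word_of n w ! Suc j)))"
proof -
  have fA: "finite A"
    using assms by (intro finite_subset [OF _ finite_permutations [of "{1..n}"]]) auto
  have fL: "finite (labelings m n)" by (rule finite_PiE_dflt) auto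
  have "{lab \<in> labelings m n. shelf_perm m n lab \<in> A} =
    (\<Union>w \<in> A. {lab \<in> labelings m n. shelf_perm m n lab = w})" by auto
  then have "card {lab \<in> labelings m n. shelf_perm m n lab \<in> A} =
    (\<Sum>w \<in> A. card {lab \<in> labelings m n. shelf_perm m n lab = w})"
    using fA fL by (simp only:) (rule card_UN_disjoint, auto)
  also have "\<dots> = (\<Sum>w \<in> A. card (label_words m n (\<lambda>j. word_of n w ! j < word_of n w ! Suc j)))"
  proof (rule sum.cong [OF refl])
    fix w assume "w \<in> A"
    then have w: "w permutes {1..n}" using assms by blast
    have "shelf_perm m n lab = w \<longleftrightarrow> rev (shelf_deck m n lab) = word_of n w"
      if "lab \<in> labelings m n" for lab
    proof -
      have "shelf_perm m n lab permutes {1..n}"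
        using that by (intro shelf_perm_permutes) (rule labelingsD)
      then show ?thesis using word_of_shelf_perm [OF that] permutes_eqI_word_of [OF _ w] by metis
    qed
    then have "{lab \<in> labelings m n. shelf_perm m n lab = w} =
      {lab \<in> labelings m n. rev (shelf_deck m n lab) = word_of n w}" by auto
    then show "card {lab \<in> labelings m n. shelf_perm m n lab = w} =
      card (label_words m n (\<lambda>j. word_of n w ! j < word_of n w ! Suc j))"
      using card_labelings_deck [OF word_of_permutes [OF w]] by simp
  qed
  finally show ?thesis .
qed

lemma label_words_cong:
  "(\<And>j. Suc j < n \<Longrightarrow> D j \<longleftrightarrow> D' j) \<Longrightarrow> label_words m n D = label_words m n D'"
  by (auto simp: label_words_def)

section \<open>Fibres of the correspondence\<close>

lemma bij_betw_rsk_word: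
  assumes lam: "is_partition lam" "sum_list lam = n"
  shows "bij_betw (\<lambda>w. rsk_word (word_of n w))
    {w. w permutes {1..n} \<and> snd (rsk_word (word_of n w)) \<in> lattice_words (row_size lam)}
    (SYT lam \<times> lattice_words (row_size lam))"
proof (rule bij_betwI')
  fix w w'
  assume "w \<in> {w. w permutes {1..n} \<and> snd (rsk_word (word_of n w)) \<in> lattice_words (row_size lam)}"
    "w' \<in> {w. w permutes {1..n} \<and> snd (rsk_word (word_of n w)) \<in> lattice_words (row_size lam)}"
  then have w: "w permutes {1..n}" "w' permutes {1..n}" by auto
  then show "rsk_word (word_of n w) = rsk_word (word_of n w') \<longleftrightarrow> w = w'"
    using rsk_word_inj word_of_permutes(1) permutes_eqI_word_of by metis
next
  fix w assume w: "w \<in> {w. w permutes {1..n} \<and> snd (rsk_word (word_of n w)) \<in> lattice_words (row_size lam)}"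
  then have "fst (rsk_word (word_of n w)) \<in> SYT lam"
    using rsk_word_tableau [of "word_of n w"] word_of_permutes [of w n] row_length_rsk_word [of "word_of n w"]
    by (auto simp: SYT_iff [OF lam(1)] lam(2) lattice_words_def simp del: set_word_of)
  then show "rsk_word (word_of n w) \<in> SYT lam \<times> lattice_words (row_size lam)"
    using w by (auto simp: mem_Times_iff)
next
  fix p assume "p \<in> SYT lam \<times> lattice_words (row_size lam)"
  then obtain P s where p: "p = (P, s)" "P \<in> SYT lam" "s \<in> lattice_words (row_size lam)" by auto
  have "is_tableau P" "entries P = {1..n}" "row_length P = count_list s" "lattice_word s"
    using p lam(2) by (auto simp: SYT_iff [OF lam(1)] lattice_words_def)
  then obtain xs where xs: "distinct xs" "rsk_word xs = (P, s)" using rsk_word_surj by metis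
  then have "set xs = {1..n}" using rsk_word_tableau [OF xs(1)] \<open>entries P = {1..n}\<close> by simp
  then obtain w where "w permutes {1..n}" "word_of n w = xs" using word_of_surj xs(1) by metis
  then show "\<exists>w \<in> {w. w permutes {1..n} \<and> snd (rsk_word (word_of n w)) \<in> lattice_words (row_size lam)}.
    p = rsk_word (word_of n w)"
    using p xs by auto
qed

definition label_count :: "nat \<Rightarrow> nat list \<Rightarrow> nat" where
  "label_count m lam = (\<Sum>s \<in> lattice_words (row_size lam).
     card (label_words m (sum_list lam) (\<lambda>j. s ! Suc j < s ! j)))"

lemma rsk_shape_iff:
  assumes "is_partition lam" "w permutes {1..n}"
  shows "rsk_shape n w = lam \<longleftrightarrow> snd (rsk_word (word_of n w)) \<in> lattice_words (row_size lam)"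
proof -
  let ?s = "snd (rsk_word (word_of n w))"
  have l: "lattice_word ?s" by (rule lattice_rsk_word) (rule word_of_permutes [OF assms(2)])
  have "rsk_shape n w = shape (tableau_of ?s)"
    by (simp add: rsk_shape_def recording_tableau_def rsk_eq_word_of)
  also have "\<dots> = lam \<longleftrightarrow> count_list ?s = row_size lam"
    using shape_eq_iff [of "tableau_of ?s" lam] tableau_of_lattice_word [OF l] assms(1)
    by (simp add: is_partition_def)
  finally show ?thesis using l by (simp add: lattice_words_def)
qed

lemma card_labelings_rsk_shape:
  assumes "is_partition lam" "sum_list lam = n"
  shows "card {lab \<in> labelings m n. rsk_shape n (shelf_perm m n lab) = lam} =
    f_SYT lam * label_count m lam"
proof -
  define A where "A = {w. w permutes {1..n} \<and> snd (rsk_word (word_of n w)) \<in> lattice_words (row_size lam)}"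
  have "rsk_shape n (shelf_perm m n lab) = lam \<longleftrightarrow> shelf_perm m n lab \<in> A" if "lab \<in> labelings m n" for lab
  proof -
    have "shelf_perm m n lab permutes {1..n}"
      using that by (intro shelf_perm_permutes) (rule labelingsD)
    then show ?thesis using rsk_shape_iff [OF assms(1)] by (simp add: A_def)
  qed
  then have "{lab \<in> labelings m n. rsk_shape n (shelf_perm m n lab) = lam} =
    {lab \<in> labelings m n. shelf_perm m n lab \<in> A}" by auto
  then have "card {lab \<in> labelings m n. rsk_shape n (shelf_perm m n lab) = lam} =
    (\<Sum>w \<in> A. card (label_words m n (\<lambda>j. word_of n w ! j < word_of n w ! Suc j)))"
    by (simp only:) (rule card_labelings_shelf_perm, simp add: A_def)
  also have "\<dots> = (\<Sum>w \<in> A. (\<lambda>(P, s). card (label_words m n (\<lambda>j. s ! Suc j < s ! j))) (rsk_word (word_of n w)))"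
  proof (rule sum.cong [OF refl])
    fix w assume "w \<in> A"
    then have "distinct (word_of n w)" using word_of_permutes by (simp add: A_def)
    then show "card (label_words m n (\<lambda>j. word_of n w ! j < word_of n w ! Suc j)) =
      (\<lambda>(P, s). card (label_words m n (\<lambda>j. s ! Suc j < s ! j))) (rsk_word (word_of n w))"
      unfolding split_beta
      by (intro arg_cong [of _ _ card] label_words_cong) (simp add: rsk_word_descent)
  qed
  also have "\<dots> = (\<Sum>(P, s) \<in> SYT lam \<times> lattice_words (row_size lam).
      card (label_words m n (\<lambda>j. s ! Suc j < s ! j)))"
    using bij_betw_rsk_word [OF assms] unfolding A_def by (rule sum.reindex_bij_betw)
  also have "\<dots> = f_SYT lam * label_count m lam"
    by (simp add: sum.cartesian_product [symmetric] f_SYT_def label_count_def assms(2))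
  finally show ?thesis .
qed

lemma card_labelings_recording_tableau:
  assumes "is_partition lam" "sum_list lam = n" "T \<in> SYT lam"
  shows "card {lab \<in> labelings m n. recording_tableau n (inv_into UNIV (shelf_perm m n lab)) = T} =
    label_count m lam"
proof -
  define A where "A = {w. w permutes {1..n} \<and> recording_tableau n (inv_into UNIV w) = T}"
  obtain t where t: "t \<in> lattice_words (row_size lam)" "T = tableau_of t"
    using bij_betw_tableau_of [OF assms(1)] assms(3) by (auto simp: bij_betw_def)
  define U where "U = {u. u permutes {1..n} \<and> snd (rsk_word (word_of n u)) = t}"
  have rec: "recording_tableau n u = T \<longleftrightarrow> snd (rsk_word (word_of n u)) = t" if "u permutes {1..n}" for u
    using tableau_of_inj [of "snd (rsk_word (word_of n u))" t] t
      lattice_rsk_word [OF word_of_permutes(1) [OF that]]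
    by (auto simp: recording_tableau_def rsk_eq_word_of lattice_words_def)
  have bA: "bij_betw (inv_into UNIV) A U"
  proof (rule bij_betwI [where g = "inv_into UNIV"])
    show "inv_into UNIV \<in> A \<rightarrow> U" using rec permutes_inv by (auto simp: A_def U_def)
    show "inv_into UNIV \<in> U \<rightarrow> A" using rec permutes_inv by (auto simp: A_def U_def permutes_inv_inv)
  qed (auto simp: A_def U_def permutes_inv_inv)
  \<comment> \<open>\<open>U\<close> is the fibre of Robinson--Schensted over a fixed second
    component, so the first component runs freely through \<open>SYT lam\<close>.\<close>
  have bU: "bij_betw (\<lambda>u. fst (rsk_word (word_of n u))) U (SYT lam)"
  proof -
    let ?f = "\<lambda>w. rsk_word (word_of n w)"
    let ?B = "{w. w permutes {1..n} \<and> snd (?f w) \<in> lattice_words (row_size lam)}"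
    have f: "bij_betw ?f ?B (SYT lam \<times> lattice_words (row_size lam))"
      by (rule bij_betw_rsk_word [OF assms(1,2)])
    have UB: "U \<subseteq> ?B" using t(1) by (simp add: U_def subset_eq)
    have "?f ` U = SYT lam \<times> {t}"
    proof (intro equalityI subsetI)
      fix p assume "p \<in> ?f ` U"
      then obtain w where w: "w \<in> U" "p = ?f w" by blast
      then show "p \<in> SYT lam \<times> {t}"
        using bij_betw_apply [OF f, of w] UB by (auto simp: U_def mem_Times_iff)
    next
      fix p assume p: "p \<in> SYT lam \<times> {t}"
      then have "p \<in> ?f ` ?B" using t(1) bij_betw_imp_surj_on [OF f] by auto
      then obtain w where "w \<in> ?B" "p = ?f w" by blast
      then show "p \<in> ?f ` U" using p by (auto simp: U_def mem_Times_iff)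
    qed
    from bij_betw_subset [OF f UB this] have b: "bij_betw ?f U (SYT lam \<times> {t})" .
    have "bij_betw fst (SYT lam \<times> {t}) (SYT lam)" by (auto simp: bij_betw_def inj_on_def)
    from bij_betw_trans [OF b this] show ?thesis by (simp add: o_def)
  qed
  have bS: "bij_betw (inv_into (lattice_words (row_size lam)) tableau_of) (SYT lam) (lattice_words (row_size lam))"
    by (rule bij_betw_inv_into) (rule bij_betw_tableau_of [OF assms(1)])
  \<comment> \<open>\<open>g w\<close> is the insertion tableau of the inverse of \<open>w\<close>,
    rewritten as a lattice word so that the sum takes the form of
    \<open>label_count\<close>.\<close>
  define g where "g w = inv_into (lattice_words (row_size lam)) tableau_of (fst (rsk_word (word_of n (inv_into UNIV w))))" for w
  have bg: "bij_betw g A (lattice_words (row_size lam))"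
    using bij_betw_trans [OF bij_betw_trans [OF bA bU] bS] by (simp add: g_def [abs_def] o_def)
  have "recording_tableau n (inv_into UNIV (shelf_perm m n lab)) = T \<longleftrightarrow> shelf_perm m n lab \<in> A"
    if "lab \<in> labelings m n" for lab
  proof -
    have "shelf_perm m n lab permutes {1..n}"
      using that by (intro shelf_perm_permutes) (rule labelingsD)
    then show ?thesis by (simp add: A_def)
  qed
  then have "{lab \<in> labelings m n. recording_tableau n (inv_into UNIV (shelf_perm m n lab)) = T} =
    {lab \<in> labelings m n. shelf_perm m n lab \<in> A}" by auto
  then have "card {lab \<in> labelings m n. recording_tableau n (inv_into UNIV (shelf_perm m n lab)) = T} =
    (\<Sum>w \<in> A. card (label_words m n (\<lambda>j. word_of n w ! j < word_of n w ! Suc j)))"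
    by (simp only:) (rule card_labelings_shelf_perm, simp add: A_def)
  also have "\<dots> = (\<Sum>w \<in> A. card (label_words m n (\<lambda>j. g w ! Suc j < g w ! j)))"
  proof (rule sum.cong [OF refl])
    fix w assume wA: "w \<in> A"
    then have w: "w permutes {1..n}" by (simp add: A_def)
    define u where "u = inv_into UNIV w"
    have u: "u permutes {1..n}" using w by (simp add: u_def permutes_inv)
    have uw: "u (w i) = i" for i using w by (simp add: u_def permutes_inverses)
    let ?P = "fst (rsk_word (word_of n u))"
    have "?P \<in> SYT lam"
      unfolding u_def by (rule bij_betw_apply [OF bU bij_betw_apply [OF bA wA]])
    then have g: "g w \<in> lattice_words (row_size lam)" "tableau_of (g w) = ?P"
      using bij_betw_apply [OF bg wA] bij_betw_inv_into_right [OF bij_betw_tableau_of [OF assms(1)]]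
      by (simp_all add: g_def u_def)
    have len: "length (g w) = n" using g(1) length_lattice_word [of "g w" lam] assms(2) by (simp add: lattice_words_def)
    have "word_of n w ! j < word_of n w ! Suc j \<longleftrightarrow> g w ! Suc j < g w ! j" if j: "Suc j < n" for j
    proof -
      \<comment> \<open>\<open>?i\<close> and \<open>?k\<close> are the places, in the reversed word
        of \<open>u\<close>, of the consecutive letters \<open>n - Suc j\<close> and
        \<open>n - j\<close>: at place \<open>n - w v\<close> stands
        \<open>u (w v) = v\<close>.\<close>
      let ?x = "word_of n u" and ?i = "n - w (n - Suc j)" and ?k = "n - w (n - j)"
      have "n - Suc j \<in> {1..n}" "n - j \<in> {1..n}" using j by auto
      then have rng: "w (n - Suc j) \<in> {1..n}" "w (n - j) \<in> {1..n}"
        by (simp_all only: permutes_in_image [OF w])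
      have ik: "?i < n" "?k < n" "n - ?i = w (n - Suc j)" "n - ?k = w (n - j)"
        using rng unfolding atLeastAtMost_iff by linarith+
      have nth: "?x ! ?i = n - Suc j" "?x ! ?k = n - j"
        using ik by (simp_all only: nth_word_of uw)
      have adj: "c \<le> n - Suc j \<or> n - j \<le> c" for c using j by linarith
      have "lower_row (?x ! ?i) (?x ! ?k) ?P \<longleftrightarrow> ?i < ?k"
      proof (rule lower_row_rsk_word)
        show "distinct ?x" by (rule word_of_permutes [OF u])
        show "?x ! ?i < ?x ! ?k" unfolding nth using j by linarith
        show "\<forall>c \<in> set ?x. c \<le> ?x ! ?i \<or> ?x ! ?k \<le> c" unfolding nth using adj by blast
      qed (simp_all only: length_word_of ik)
      moreover have "lower_row (n - Suc j) (n - j) ?P \<longleftrightarrow> g w ! Suc j < g w ! j"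
        using lower_row_tableau_of [of "g w" j] g len j by (simp add: lattice_words_def)
      ultimately have "g w ! Suc j < g w ! j \<longleftrightarrow> ?i < ?k" unfolding nth by simp
      also have "\<dots> \<longleftrightarrow> w (n - j) < w (n - Suc j)" using rng unfolding atLeastAtMost_iff by linarith
      finally show ?thesis using j by (simp add: nth_word_of)
    qed
    then show "card (label_words m n (\<lambda>j. word_of n w ! j < word_of n w ! Suc j)) =
      card (label_words m n (\<lambda>j. g w ! Suc j < g w ! j))"
      by (intro arg_cong [of _ _ card] label_words_cong)
  qed
  also have "\<dots> = label_count m lam"
    unfolding label_count_def assms(2)
    using bg by (rule sum.reindex_bij_betw [where g = "\<lambda>s. card (label_words m n (\<lambda>j. s ! Suc j < s ! j))"])
  finally show ?thesis .
qed

section \<open>Determinants and single cells\<close>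

text \<open>The cofactors along row \<open>i\<close> do not see that row, so they agree for the
  three matrices.\<close>

lemma det_row_linear:
  fixes A B C :: "'a :: comm_ring_1 mat"
  assumes c: "A \<in> carrier_mat l l" "B \<in> carrier_mat l l" "C \<in> carrier_mat l l" and i: "i < l"
    and row: "\<And>j. j < l \<Longrightarrow> A $$ (i, j) = B $$ (i, j) + y * C $$ (i, j)"
    and B: "\<And>r j. r < l \<Longrightarrow> j < l \<Longrightarrow> r \<noteq> i \<Longrightarrow> B $$ (r, j) = A $$ (r, j)"
    and C: "\<And>r j. r < l \<Longrightarrow> j < l \<Longrightarrow> r \<noteq> i \<Longrightarrow> C $$ (r, j) = A $$ (r, j)"
  shows "Determinant.det A = Determinant.det B + y * Determinant.det C"
proof -
  have del: "mat_delete A' i j = mat_delete A i j"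
    if "A' \<in> carrier_mat l l" "j < l" "\<And>r j. r < l \<Longrightarrow> j < l \<Longrightarrow> r \<noteq> i \<Longrightarrow> A' $$ (r, j) = A $$ (r, j)" for A' j
    using that c(1) i by (intro eq_matI) (auto simp: mat_delete_def)
  have cof: "cofactor B i j = cofactor A i j" "cofactor C i j = cofactor A i j" if "j < l" for j
    using del [OF c(2) that B] del [OF c(3) that C] by (simp_all add: cofactor_def)
  have "Determinant.det A = (\<Sum>j<l. B $$ (i, j) * cofactor A i j + y * (C $$ (i, j) * cofactor A i j))"
    unfolding laplace_expansion_row [OF c(1) i]
    by (rule sum.cong [OF refl]) (simp add: row algebra_simps)
  also have "\<dots> = Determinant.det B + y * Determinant.det C"
    unfolding laplace_expansion_row [OF c(2) i] laplace_expansion_row [OF c(3) i]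
    by (simp add: sum.distrib sum_distrib_left cof)
  finally show ?thesis .
qed

lemma det_zero_row:
  fixes A :: "'a :: comm_ring_1 mat"
  assumes "A \<in> carrier_mat l l" "i < l" "\<And>j. j < l \<Longrightarrow> A $$ (i, j) = 0"
  shows "Determinant.det A = 0"
  unfolding laplace_expansion_row [OF assms(1,2)] using assms(3) by simp

section \<open>Generating functions and determinants for a growing alphabet\<close>

definition coef :: "real fps \<Rightarrow> int \<Rightarrow> real" where
  "coef f r = (if r < 0 then 0 else fps_nth f (nat r))"

lemma coef_neg: "r < 0 \<Longrightarrow> coef f r = 0"
  by (simp add: coef_def)

lemma coef_mult_linear: "coef (f * (1 + fps_const c * fps_X)) r = coef f r + c * coef f (r - 1)"
proof -
  have "f * (1 + fps_const c * fps_X) = f + fps_const c * (f * fps_X)" by (simp add: algebra_simps)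
  then show ?thesis by (auto simp: coef_def nat_diff_distrib)
qed

text \<open>Letter \<open>k\<close> stands for the label \<open>k + 1\<close>: the packets with even \<open>k\<close> are increasing and
  contribute horizontal strips, those with odd \<open>k\<close> contribute vertical strips.\<close>

definition letter_fps :: "real \<Rightarrow> nat \<Rightarrow> real fps" where
  "letter_fps y k = (if even k then inverse (1 - fps_const y * fps_X) else 1 + fps_const y * fps_X)"

definition alphabet_fps :: "real \<Rightarrow> nat \<Rightarrow> real fps" where
  "alphabet_fps y k = (\<Prod>j<k. letter_fps y j)"

text \<open>Both kinds of letters give one form of recursion: \<open>G = F / (1 - y t)\<close> means
  \<open>G = F + y t G\<close>, and \<open>G = F (1 + y t)\<close> means
  \<open>G = F + y t F\<close>. The term with \<open>y\<close> uses the new alphabet if the letter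
  may be repeated in a row, and the old one if not.\<close>

lemma coef_alphabet_Suc:
  "coef (alphabet_fps y (Suc k)) r =
    coef (alphabet_fps y k) r + y * coef (alphabet_fps y (if even k then Suc k else k)) (r - 1)"
proof (cases "even k")
  case True
  have "inverse (1 - fps_const y * fps_X) * (1 - fps_const y * fps_X) = (1 :: real fps)"
    by (rule inverse_mult_eq_1) simp
  then have "alphabet_fps y (Suc k) * (1 + fps_const (- y) * fps_X) = alphabet_fps y k"
    using True by (simp add: alphabet_fps_def letter_fps_def mult.assoc fps_const_neg [symmetric]
        del: fps_const_neg)
  from coef_mult_linear [of "alphabet_fps y (Suc k)" "- y" r, unfolded this] True
  show ?thesis by simp
next
  case False
  then have "alphabet_fps y (Suc k) = alphabet_fps y k * (1 + fps_const y * fps_X)"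
    by (simp add: alphabet_fps_def letter_fps_def)
  then show ?thesis using False by (simp add: coef_mult_linear)
qed

text \<open>A super-tableau is filled cell by cell: the pairs (letter, row) are enumerated by codes \<open>e\<close>,
  where an even letter runs through the rows from the bottom to the top and an odd letter
  from the top to the bottom. In this order a code of an even letter may be repeated, while a code
  of an odd letter occurs at most once.\<close>

definition code_row :: "nat \<Rightarrow> nat \<Rightarrow> nat" where
  "code_row l e = (if even (e div l) then l - 1 - e mod l else e mod l)"

text \<open>Row \<open>r\<close> receives the letters whose code in that row is below
  \<open>e\<close>. The current letter \<open>e div l\<close> has passed \<open>e mod l\<close>
  rows, the lowest ones if it is even and the highest ones if it is odd.\<close>

definition row_fps :: "real \<Rightarrow> nat \<Rightarrow> nat \<Rightarrow> nat \<Rightarrow> real fps" where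
  "row_fps y l e r = alphabet_fps y
     (if (if even (e div l) then l - e mod l \<le> r else r < e mod l) then Suc (e div l) else e div l)"

text \<open>The row lengths are integers because a cell may be removed formally from an empty
  row.\<close>

definition code_det :: "real \<Rightarrow> nat \<Rightarrow> nat \<Rightarrow> (nat \<Rightarrow> int) \<Rightarrow> real" where
  "code_det y l e lam = Determinant.det (Matrix.mat l l
     (\<lambda>(r, c). coef (row_fps y l e r) (lam r - int r + int c)))"

lemma code_row_less: "0 < l \<Longrightarrow> code_row l e < l"
  by (auto simp: code_row_def)

lemma row_fps_code_row:
  assumes "0 < l"
  shows "row_fps y l e (code_row l e) = alphabet_fps y (e div l)"
  using mod_less_divisor [OF assms, of e] by (auto simp: row_fps_def code_row_def)

lemma row_fps_Suc:
  assumes "0 < l" "r < l"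
  shows "row_fps y l (Suc e) r =
    (if r = code_row l e then alphabet_fps y (Suc (e div l)) else row_fps y l e r)"
\<comment> \<open>After the last row of a letter, the next code belongs to the following letter,
  which has passed no row yet.\<close>
proof (cases "Suc (e mod l) = l")
  case True
  then have "Suc e div l = Suc (e div l)" "Suc e mod l = 0"
    by (auto simp: div_Suc mod_Suc)
  then show ?thesis using assms True by (auto simp: row_fps_def code_row_def)
next
  case False
  then have "Suc e div l = e div l" "Suc e mod l = Suc (e mod l)" using assms
    by (auto simp: div_Suc mod_Suc)
  then show ?thesis using assms mod_less_divisor [OF assms(1), of e] by (auto simp: row_fps_def code_row_def)
qed

text \<open>Strict bound for the codes that remain once a cell with code \<open>e\<close> is removed
  as the largest: \<open>e\<close> itself may recur only for an even letter.\<close>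

abbreviation repeat_code :: "nat \<Rightarrow> nat \<Rightarrow> nat" where
  "repeat_code l e \<equiv> (if even (e div l) then Suc e else e)"

lemma row_fps_repeat:
  assumes "0 < l"
  shows "row_fps y l (repeat_code l e) (code_row l e) =
    alphabet_fps y (if even (e div l) then Suc (e div l) else e div l)"
  using row_fps_Suc [OF assms code_row_less [OF assms]] row_fps_code_row [OF assms] by simp

text \<open>Passing from \<open>e\<close> to \<open>Suc e\<close> changes the alphabet of the single
  row \<open>code_row l e\<close>. The index shift \<open>r - 1\<close> in the recursion for
  coefficients appears as the removal of a cell from that row.\<close>

lemma code_det_Suc:
  assumes "0 < l"
  shows "code_det y l (Suc e) lam = code_det y l e lam +
    y * code_det y l (repeat_code l e) (lam(code_row l e := lam (code_row l e) - 1))"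
  unfolding code_det_def
proof (rule det_row_linear [where i = "code_row l e"])
  show i: "code_row l e < l" by (rule code_row_less [OF assms])
  fix j assume "j < l"
  have "coef (row_fps y l (Suc e) (code_row l e)) z = coef (row_fps y l e (code_row l e)) z +
     y * coef (row_fps y l (repeat_code l e) (code_row l e)) (z - 1)" for z
    unfolding row_fps_repeat [OF assms] row_fps_code_row [OF assms] row_fps_Suc [OF assms i]
    using coef_alphabet_Suc [of y "e div l" z] by simp
  note this [of "lam (code_row l e) - int (code_row l e) + int j"]
  then show "Matrix.mat l l (\<lambda>(r, c). coef (row_fps y l (Suc e) r) (lam r - int r + int c)) $$ (code_row l e, j) =
    Matrix.mat l l (\<lambda>(r, c). coef (row_fps y l e r) (lam r - int r + int c)) $$ (code_row l e, j) +
    y * Matrix.mat l l (\<lambda>(r, c). coef (row_fps y l (repeat_code l e) r)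
       ((lam(code_row l e := lam (code_row l e) - 1)) r - int r + int c)) $$ (code_row l e, j)"
    using i \<open>j < l\<close> by (simp add: algebra_simps)
qed (use assms in \<open>auto simp: row_fps_Suc\<close>)

text \<open>If row \<open>code_row l e\<close> is no longer than the next one, removing a cell from it makes
  two rows of the matrix equal, or the last row zero.\<close>

lemma code_det_no_corner:
  assumes l: "0 < l" and i: "i = code_row l e"
    and "Suc i < l \<Longrightarrow> lam i = lam (Suc i)" "Suc i = l \<Longrightarrow> lam i = 0"
  shows "code_det y l (repeat_code l e) (lam(i := lam i - 1)) = 0"
proof (cases "Suc i = l")
  case True
  show ?thesis unfolding code_det_def
    \<comment> \<open>The length becomes \<open>-1\<close>, so in the last row all indices are
      negative.\<close>
    by (rule det_zero_row [where i = i and l = l]) (use True assms(4) in \<open>auto simp: coef_neg\<close>)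
next
  case False
  then have si: "Suc i < l" using code_row_less [OF l, of e] i by simp
  have m: "e mod l < l" using l by simp
  \<comment> \<open>An even letter has already passed row \<open>Suc i\<close>, and
    \<open>repeat_code\<close> lets it pass row \<open>i\<close> as well; an odd letter has passed
    neither of them.\<close>
  have "row_fps y l (repeat_code l e) i = row_fps y l (repeat_code l e) (Suc i)"
  proof (cases "even (e div l)")
    case True
    then have ne: "Suc i \<noteq> code_row l e" using i by simp
    have "row_fps y l e (Suc i) = alphabet_fps y (Suc (e div l))"
      using True m si i by (auto simp: row_fps_def code_row_def)
    then show ?thesis using True row_fps_Suc [OF l, of "Suc i" y e] row_fps_Suc [OF l, of i y e] si i by simp
  next
    case False
    then show ?thesis using i by (auto simp: row_fps_def code_row_def)
  qed
  then show ?thesis unfolding code_det_def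
    using si assms(3) [OF si]
    by (intro det_identical_rows [where i = i and j = "Suc i" and n = l]) (auto intro!: eq_vecI simp: diff_diff_eq)
qed

text \<open>Without letters every generating function is \<open>1\<close>. If
  \<open>c 0 > 0\<close>, the first row asks only for coefficients of positive index, which are
  zero.\<close>

lemma code_det_0:
  assumes "0 < l" "antimono c"
  shows "code_det y l 0 (\<lambda>r. int (c r)) = (if c 0 = 0 then 1 else 0)"
proof (cases "c 0 = 0")
  case True
  have z: "c r = 0" for r using True antimonoD [OF assms(2), of 0 r] by simp
  have "row_fps y l 0 r = 1" if "r < l" for r
    using that by (auto simp: row_fps_def alphabet_fps_def)
  then have "Matrix.mat l l (\<lambda>(r, j). coef (row_fps y l 0 r) (int (c r) - int r + int j)) = 1\<^sub>m l"
    using z by (intro eq_matI) (auto simp: coef_def)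
  then show ?thesis using True by (simp add: code_det_def)
next
  case False
  have "row_fps y l 0 0 = 1" using assms(1) by (auto simp: row_fps_def alphabet_fps_def)
  then show ?thesis unfolding code_det_def
    using False assms(1) by (subst det_zero_row [where i = 0 and l = l]) (auto simp: coef_def)
qed

section \<open>Counting super-tableaux\<close>

text \<open>Super-tableaux as lists of cells, the largest first. Each code gives letter and row, and
  the lattice condition keeps all intermediate shapes partitions, so the columns need not be
  recorded.\<close>

definition code_words :: "nat \<Rightarrow> nat \<Rightarrow> (nat \<Rightarrow> nat) \<Rightarrow> nat list set" where
  "code_words l e c = {es. set es \<subseteq> {..<e} \<and>
     sorted_wrt (\<lambda>new old. old < new \<or> old = new \<and> even (new div l)) es \<and>
     map (code_row l) es \<in> lattice_words c}"

lemma length_code_words: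
  assumes "0 < l" "es \<in> code_words l e c"
  shows "length es = (\<Sum>r<l. c r)"
proof -
  have c: "count_list (map (code_row l) es) = c"
    using assms(2) by (auto simp: code_words_def lattice_words_def)
  have "set (map (code_row l) es) \<subseteq> {..<l}" using code_row_less [OF assms(1)] by auto
  from sum_count_set [OF this] show ?thesis unfolding c by simp
qed

lemma finite_code_words: "0 < l \<Longrightarrow> finite (code_words l e c)"
  by (rule finite_subset [OF _ finite_lists_length_eq [of "{..<e}" "\<Sum>r<l. c r"]])
    (auto simp: length_code_words, auto simp: code_words_def)

lemma code_words_antimono: "es \<in> code_words l e c \<Longrightarrow> c (Suc i) \<le> c i"
  using lattice_word_antimono by (auto simp: code_words_def lattice_words_def)

text \<open>Codes decrease weakly along the list, so \<open>e\<close> is either absent or the head.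
  Removing the head is the counterpart of the term with \<open>y\<close> in
  \<open>code_det_Suc\<close>.\<close>

lemma code_words_Suc:
  fixes c :: "nat \<Rightarrow> nat"
  assumes "antimono c" "0 < c (code_row l e)"
  defines "c' \<equiv> c(code_row l e := c (code_row l e) - 1)"
  shows "code_words l (Suc e) c = code_words l e c \<union> (#) e ` code_words l (repeat_code l e) c'"
proof (intro equalityI subsetI)
  fix es assume es: "es \<in> code_words l (Suc e) c"
  show "es \<in> code_words l e c \<union> (#) e ` code_words l (repeat_code l e) c'"
  proof (cases "e \<in> set es")
    case False
    then have "set es \<subseteq> {..<e}" using es by (auto simp: code_words_def less_Suc_eq subset_iff)
    then show ?thesis using es by (auto simp: code_words_def)
  next
    case True
    then obtain x fs where x: "es = x # fs" by (cases es) auto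
    have srt: "\<forall>f \<in> set fs. f < x \<or> f = x \<and> even (x div l)" "x < Suc e" "set fs \<subseteq> {..<Suc e}"
      using es by (auto simp: code_words_def x)
    have "x = e" using True srt by (auto simp: x)
    have "set fs \<subseteq> {..<repeat_code l e}" using srt(1) \<open>x = e\<close> by auto
    moreover have "count_list (map (code_row l) fs) = c'"
      using es by (auto simp: code_words_def lattice_words_def x \<open>x = e\<close> c'_def)
    ultimately have "fs \<in> code_words l (repeat_code l e) c'"
      using es by (auto simp: code_words_def lattice_words_def x)
    then show ?thesis using x \<open>x = e\<close> by blast
  qed
next
  fix es assume "es \<in> code_words l e c \<union> (#) e ` code_words l (repeat_code l e) c'"
  then show "es \<in> code_words l (Suc e) c"
  proof
    assume "es \<in> code_words l e c"
    then show ?thesis by (auto simp: code_words_def)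
  next
    assume "es \<in> (#) e ` code_words l (repeat_code l e) c'"
    then obtain fs where fs: "es = e # fs" "fs \<in> code_words l (repeat_code l e) c'" by blast
    have cnt: "count_list (map (code_row l) fs) = c'" using fs by (auto simp: code_words_def lattice_words_def)
    \<comment> \<open>Here the partition condition on \<open>c\<close> enters: one cell less than
      \<open>c\<close> has in this row is fewer than the row above has.\<close>
    have "code_row l e = 0 \<or> c' (code_row l e) < c' (code_row l e - 1)"
      using antimonoD [OF assms(1), of "code_row l e - 1" "code_row l e"] assms(2)
      by (auto simp: c'_def)
    moreover have "count_list (map (code_row l) es) r = c r" for r
      using fun_cong [OF cnt, of r] assms(2) by (simp add: fs(1) c'_def split: if_splits)
    then have "count_list (map (code_row l) es) = c" ..
    moreover have "\<forall>f \<in> set fs. f < e \<or> f = e \<and> even (e div l)"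
      using fs(2) by (auto simp: code_words_def less_Suc_eq subset_iff split: if_splits)
    ultimately show ?thesis
      using fs(2) cnt by (auto simp: code_words_def lattice_words_def fs(1))
  qed
qed

lemma code_words_Suc_empty:
  assumes "c (code_row l e) = 0"
  shows "code_words l (Suc e) c = code_words l e c"
proof (intro equalityI subsetI)
  fix es assume es: "es \<in> code_words l (Suc e) c"
  then have "count_list (map (code_row l) es) (code_row l e) = 0"
    using assms by (auto simp: code_words_def lattice_words_def)
  then have "e \<notin> set es" by (auto simp: count_list_0_iff)
  then have "set es \<subseteq> {..<e}" using es by (auto simp: code_words_def less_Suc_eq subset_iff)
  then show "es \<in> code_words l e c" using es by (auto simp: code_words_def)
qed (auto simp: code_words_def)

lemma code_words_0: "code_words l 0 c = (if c = (\<lambda>_. 0) then {[]} else {})"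
  by (auto simp: code_words_def lattice_words_def fun_eq_iff)

text \<open>For an even letter the recursion keeps the code bound \<open>Suc e\<close> and only
  loses a cell; hence the inner induction on the number of cells.\<close>

lemma code_det_eq_card:
  assumes "0 < l" "antimono c" "\<forall>r\<ge>l. c r = 0"
  shows "code_det y l e (\<lambda>r. int (c r)) = y ^ (\<Sum>r<l. c r) * real (card (code_words l e c))"
  using assms(2,3)
proof (induction e arbitrary: c)
  case 0
  have "c = (\<lambda>_. 0) \<longleftrightarrow> c 0 = 0"
    using antimonoD [OF 0(1), of 0] by (auto simp: fun_eq_iff)
  then show ?case using code_det_0 [OF assms(1) 0(1)] by (auto simp: code_words_0)
next
  case (Suc e)
  define i where "i = code_row l e"
  have il: "i < l" using code_row_less [OF assms(1)] by (simp add: i_def)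
  show ?case using Suc.prems
  proof (induction "\<Sum>r<l. c r" arbitrary: c rule: less_induct)
    case less
    define lam' where "lam' = (\<lambda>r. int (c r))(i := int (c i) - 1)"
    have step: "code_det y l (Suc e) (\<lambda>r. int (c r)) = code_det y l e (\<lambda>r. int (c r)) +
        y * code_det y l (repeat_code l e) lam'"
      unfolding lam'_def i_def by (rule code_det_Suc [OF assms(1)])
    have IH: "code_det y l e (\<lambda>r. int (c r)) = y ^ (\<Sum>r<l. c r) * real (card (code_words l e c))"
      by (rule Suc.IH [OF less.prems])
    show ?case
    \<comment> \<open>If row \<open>i\<close> has no corner, the second term vanishes on both sides:
      the determinant by its rows, the words because the remaining content is not a
      partition.\<close>
    proof (cases "c (Suc i) = c i")
      case True
      have "code_det y l (repeat_code l e) lam' = 0"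
        unfolding lam'_def
        by (rule code_det_no_corner [OF assms(1) i_def, of "\<lambda>r. int (c r)"])
          (use True less.prems(2) in auto)
      moreover have "code_words l (Suc e) c = code_words l e c"
      proof (cases "c i = 0")
        case True
        then show ?thesis unfolding i_def by (rule code_words_Suc_empty)
      next
        case False
        have "code_words l (repeat_code l e) (c(i := c i - 1)) = {}"
        proof (rule equals0I)
          fix es assume "es \<in> code_words l (repeat_code l e) (c(i := c i - 1))"
          from code_words_antimono [OF this, of i] show False using True False by simp
        qed
        then show ?thesis
          using code_words_Suc [OF less.prems(1), of l e] False by (simp flip: i_def)
      qed
      ultimately show ?thesis using step IH by simp
    next
      case False
      then have corner: "c (Suc i) < c i" using antimonoD [OF less.prems(1), of i "Suc i"] by simp
      define c' where "c' = c(i := c i - 1)"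
      have lam': "lam' = (\<lambda>r. int (c' r))" using corner by (auto simp: lam'_def c'_def fun_eq_iff)
      have "c' (Suc r) \<le> c' r" for r
        using corner antimonoD [OF less.prems(1), of r "Suc r"] by (auto simp: c'_def)
      then have anti: "antimono c'" by (simp add: decseq_Suc_iff)
      have supp: "\<forall>r\<ge>l. c' r = 0" using less.prems(2) by (simp add: c'_def)
      have "(\<Sum>r<l. c r) = c i + (\<Sum>r\<in>{..<l} - {i}. c r)" "(\<Sum>r<l. c' r) = c' i + (\<Sum>r\<in>{..<l} - {i}. c' r)"
        using il by (simp_all add: sum.remove [of "{..<l}" i])
      moreover have "(\<Sum>r\<in>{..<l} - {i}. c' r) = (\<Sum>r\<in>{..<l} - {i}. c r)"
        by (rule sum.cong) (auto simp: c'_def)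
      ultimately have sum: "(\<Sum>r<l. c r) = Suc (\<Sum>r<l. c' r)" using corner by (simp add: c'_def)
      have IH': "code_det y l (repeat_code l e) lam' =
         y ^ (\<Sum>r<l. c' r) * real (card (code_words l (repeat_code l e) c'))"
        unfolding lam' using less.hyps [OF _ anti supp] Suc.IH [OF anti supp] sum by simp
      have "code_words l e c \<inter> (#) e ` code_words l (repeat_code l e) c' = {}"
      proof (rule equals0I)
        fix es assume "es \<in> code_words l e c \<inter> (#) e ` code_words l (repeat_code l e) c'"
        then have "set es \<subseteq> {..<e}" "e \<in> set es" by (auto simp: code_words_def)
        then show False by auto
      qed
      then have "card (code_words l (Suc e) c) =
        card (code_words l e c) + card (code_words l (repeat_code l e) c')"
        using code_words_Suc [OF less.prems(1), of l e] corner finite_code_words [OF assms(1)]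
        by (simp add: card_Un_disjoint card_image c'_def flip: i_def)
      then show ?thesis unfolding step IH IH' sum by (simp add: algebra_simps)
    qed
  qed
qed

section \<open>Standardization: codes as pairs of row and label\<close>

lemma less_iff_div_mod:
  fixes a b l :: nat
  shows "a < b \<longleftrightarrow> a div l < b div l \<or> a div l = b div l \<and> a mod l < b mod l"
proof (cases "a div l = b div l")
  case True
  then show ?thesis
    using div_mult_mod_eq [of a l] div_mult_mod_eq [of b l] by (metis less_irrefl nat_add_left_cancel_less)
next
  case False
  then show ?thesis using div_le_mono [of a b l] div_le_mono [of b a l]
    by (cases a b rule: linorder_cases) auto
qed

text \<open>\<open>e\<close> is the newer code. Under a repeated letter, the row index decreases
  weakly if the letter is even and increases strictly if it is odd. So the row word has a descent
  there exactly for odd letters, which are the even labels.\<close>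

lemma code_order_iff:
  assumes "0 < l"
  shows "e' < e \<or> e' = e \<and> even (e div l) \<longleftrightarrow> e' div l < e div l \<or>
    e' div l = e div l \<and> (code_row l e' < code_row l e \<longleftrightarrow> odd (e div l))"
proof (cases "e' div l = e div l")
  case True
  have m: "e mod l < l" "e' mod l < l" using assms by auto
  have "e' = e \<longleftrightarrow> e' mod l = e mod l" using True by (metis div_mult_mod_eq)
  then show ?thesis using True m less_iff_div_mod [of e' e l] by (auto simp: code_row_def)
next
  case False
  then show ?thesis using less_iff_div_mod [of e' e l] by auto
qed

text \<open>Inverse to taking the row and the label of a code; labels begin at \<open>1\<close>,
  letters at \<open>0\<close>.\<close>

definition encode :: "nat \<Rightarrow> nat \<Rightarrow> nat \<Rightarrow> nat" where
  "encode l i b = (b - 1) * l + (if even (b - 1) then l - 1 - i else i)"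

lemma
  assumes "i < l"
  shows encode_div [simp]: "encode l i b div l = b - 1"
    and code_row_encode [simp]: "code_row l (encode l i b) = i"
proof -
  define r where "r = (if even (b - 1) then l - 1 - i else i)"
  have r: "r < l" using assms by (auto simp: r_def)
  have e: "encode l i b = (b - 1) * l + r" by (simp only: encode_def r_def)
  show d: "encode l i b div l = b - 1" unfolding e using r by simp
  have "encode l i b mod l = r" unfolding e using r by simp
  then show "code_row l (encode l i b) = i"
    unfolding code_row_def d using assms by (simp add: r_def)
qed

lemma encode_code_row:
  assumes "0 < l"
  shows "encode l (code_row l e) (Suc (e div l)) = e"
proof -
  have "l - 1 - (l - 1 - e mod l) = e mod l" using mod_less_divisor [OF assms, of e] by linarith
  then have "encode l (code_row l e) (Suc (e div l)) = e div l * l + e mod l"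
    unfolding encode_def code_row_def diff_Suc_1 by (cases "even (e div l)") (simp_all only: if_True if_False)
  then show ?thesis by simp
qed

lemma sorted_codes_iff:
  assumes "0 < l"
  shows "sorted_wrt (\<lambda>new old. old < new \<or> old = new \<and> even (new div l)) es \<longleftrightarrow>
    (\<forall>j. Suc j < length es \<longrightarrow> es ! Suc j div l < es ! j div l \<or> es ! Suc j div l = es ! j div l \<and>
      (code_row l (es ! Suc j) < code_row l (es ! j) \<longleftrightarrow> odd (es ! j div l)))"
proof -
  have "transp (\<lambda>new old :: nat. old < new \<or> old = new \<and> even (new div l))"
    by (auto intro!: transpI)
  from sorted_wrt_iff_nth_Suc_transp [OF this, of es] show ?thesis
    by (simp only: code_order_iff [OF assms])
qed

lemma encode_code_words:
  assumes "0 < l" "\<forall>r\<ge>l. c r = 0" "(\<Sum>r<l. c r) = n"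
    and s: "s \<in> lattice_words c" and b: "b \<in> label_words m n (\<lambda>j. s ! Suc j < s ! j)"
  shows "map2 (encode l) s b \<in> code_words l (2 * m * l) c \<and>
    map (code_row l) (map2 (encode l) s b) = s \<and> map (\<lambda>e. Suc (e div l)) (map2 (encode l) s b) = b"
proof -
  have sl: "set s \<subseteq> {..<l}"
  proof
    fix i assume "i \<in> set s"
    then have "count_list s i \<noteq> 0" by (simp add: count_list_0_iff)
    then have "c i \<noteq> 0" using s by (simp add: lattice_words_def)
    then show "i \<in> {..<l}" using assms(2) by (meson lessThan_iff not_le)
  qed
  have "length s = n"
    using sum_count_set [OF sl] s assms(3) by (auto simp: lattice_words_def)
  moreover have lb: "length b = n" "set b \<subseteq> {1..2 * m}" using b by (auto simp: label_words_def)
  ultimately have len: "length s = n" "length b = n" by auto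
  have sn: "s ! j < l" if "j < n" for j using that sl nth_mem [of j s] len by blast
  have bn: "b ! j \<in> {1..2 * m}" if "j < n" for j using that lb nth_mem [of j b] by blast
  let ?e = "map2 (encode l) s b"
  have bS: "Suc (b ! j - 1) = b ! j" if "j < n" for j using bn [OF that] by simp
  have r: "map (code_row l) ?e = s"
    by (rule nth_equalityI) (use len sn in simp_all)
  have r': "map (\<lambda>e. Suc (e div l)) ?e = b"
    by (rule nth_equalityI) (use len sn bS in simp_all)
  have "encode l (s ! j) (b ! j) < 2 * m * l" if "j < n" for j
  proof -
    have "encode l (s ! j) (b ! j) div l < 2 * m"
      unfolding encode_div [OF sn [OF that]] using bn [OF that] unfolding atLeastAtMost_iff by linarith
    then show ?thesis using assms(1) by (simp add: div_less_iff_less_mult)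
  qed
  then have "set ?e \<subseteq> {..<2 * m * l}" using len by (auto simp: set_zip)
  moreover have "sorted_wrt (\<lambda>new old. old < new \<or> old = new \<and> even (new div l)) ?e"
    unfolding sorted_codes_iff [OF assms(1)]
  proof (intro allI impI)
    fix j assume "Suc j < length ?e"
    then have j: "Suc j < n" "j < n" using len by auto
    obtain k k' where k: "b ! j = Suc k" "b ! Suc j = Suc k'"
      using bS [OF j(1)] bS [OF j(2)] by metis
    have "b ! Suc j < b ! j \<or> b ! Suc j = b ! j \<and> (s ! Suc j < s ! j \<longleftrightarrow> even (b ! j))"
      using b j by (simp add: label_words_def)
    then show "?e ! Suc j div l < ?e ! j div l \<or> ?e ! Suc j div l = ?e ! j div l \<and>
      (code_row l (?e ! Suc j) < code_row l (?e ! j) \<longleftrightarrow> odd (?e ! j div l))"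
      using j len sn [OF j(1)] sn [OF j(2)] by (simp add: k)
  qed
  ultimately show ?thesis using r r' s by (simp add: code_words_def)
qed

text \<open>Standardization of super-tableaux: the rows alone form the lattice word of a standard
  tableau, and the order of the codes becomes compatibility of the labels with its descents. The
  bound \<open>2 * m * l\<close> admits exactly the letters below \<open>2 * m\<close>.\<close>

lemma bij_betw_code_words:
  assumes "0 < l" "\<forall>r\<ge>l. c r = 0" "(\<Sum>r<l. c r) = n"
  shows "bij_betw (\<lambda>es. (map (code_row l) es, map (\<lambda>e. Suc (e div l)) es))
    (code_words l (2 * m * l) c)
    (SIGMA s : lattice_words c. label_words m n (\<lambda>j. s ! Suc j < s ! j))"
proof (rule bij_betwI [where g = "\<lambda>(s, b). map2 (encode l) s b"])
  show "(\<lambda>es. (map (code_row l) es, map (\<lambda>e. Suc (e div l)) es)) \<in> code_words l (2 * m * l) c \<rightarrow>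
    (SIGMA s : lattice_words c. label_words m n (\<lambda>j. s ! Suc j < s ! j))"
  proof
    fix es assume es: "es \<in> code_words l (2 * m * l) c"
    then have len: "length es = n" using length_code_words [OF assms(1)] assms(3) by simp
    have "e div l < 2 * m" if "e \<in> set es" for e
      using that es assms(1) by (auto simp: code_words_def less_mult_imp_div_less)
    then have "set (map (\<lambda>e. Suc (e div l)) es) \<subseteq> {1..2 * m}" by (auto simp: Suc_le_eq)
    then show "(map (code_row l) es, map (\<lambda>e. Suc (e div l)) es) \<in>
      (SIGMA s : lattice_words c. label_words m n (\<lambda>j. s ! Suc j < s ! j))"
      using es len by (simp add: code_words_def label_words_def sorted_codes_iff [OF assms(1)])
  qed
  show "(\<lambda>(s, b). map2 (encode l) s b) \<in>
    (SIGMA s : lattice_words c. label_words m n (\<lambda>j. s ! Suc j < s ! j)) \<rightarrow> code_words l (2 * m * l) c"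
    using encode_code_words [OF assms] by auto
  show "(map (code_row l) ((\<lambda>(s, b). map2 (encode l) s b) p),
      map (\<lambda>e. Suc (e div l)) ((\<lambda>(s, b). map2 (encode l) s b) p)) = p"
    if "p \<in> (SIGMA s : lattice_words c. label_words m n (\<lambda>j. s ! Suc j < s ! j))" for p
    using encode_code_words [OF assms, of "fst p" "snd p"] that by (auto simp: split_beta)
  show "(\<lambda>(s, b). map2 (encode l) s b) (map (code_row l) es, map (\<lambda>e. Suc (e div l)) es) = es"
    if "es \<in> code_words l (2 * m * l) c" for es
    using encode_code_row [OF assms(1)] by (simp add: list_eq_iff_nth_eq)
qed

section \<open>Specialization to partitions and to \<open>S_fun\<close>\<close>

lemma sum_row_size: "(\<Sum>r<length lam. row_size lam r) = sum_list lam"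
  by (simp add: row_size_def sum_list_sum_nth atLeast0LessThan)

lemma antimono_row_size: "is_partition lam \<Longrightarrow> antimono (row_size lam)"
  by (auto simp: decseq_Suc_iff row_size_def is_partition_def intro: sorted_wrt_nth_less)

lemma finite_label_words: "finite (label_words m n D)"
  by (rule finite_subset [OF _ finite_lists_length_eq [of "{1..2 * m}" n]]) (auto simp: label_words_def)

lemma finite_lattice_words: "finite (lattice_words (row_size lam))"
proof (rule finite_subset)
  show "lattice_words (row_size lam) \<subseteq> {s. set s \<subseteq> {..<length lam} \<and> length s = sum_list lam}"
  proof
    fix s assume s: "s \<in> lattice_words (row_size lam)"
    have "i < length lam" if "i \<in> set s" for i
    proof -
      have "count_list s i \<noteq> 0" using that by (simp add: count_list_0_iff)
      then show ?thesis using s by (auto simp: lattice_words_def row_size_def split: if_splits)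
    qed
    then show "s \<in> {s. set s \<subseteq> {..<length lam} \<and> length s = sum_list lam}"
      using length_lattice_word [of s lam] s by (auto simp: lattice_words_def)
  qed
qed (rule finite_lists_length_eq, simp)

lemma card_code_words:
  assumes "lam \<noteq> []"
  shows "card (code_words (length lam) (2 * m * length lam) (row_size lam)) = label_count m lam"
proof -
  have "card (code_words (length lam) (2 * m * length lam) (row_size lam)) =
    card (SIGMA s : lattice_words (row_size lam). label_words m (sum_list lam) (\<lambda>j. s ! Suc j < s ! j))"
    using assms by (intro bij_betw_same_card [OF bij_betw_code_words]) (auto simp: sum_row_size, simp add: row_size_def)
  also have "\<dots> = label_count m lam"
    unfolding label_count_def
    by (rule card_SigmaI) (auto intro: finite_lattice_words finite_label_words)
  finally show ?thesis .
qed

lemma alphabet_fps_double: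
  "alphabet_fps y (2 * m) = (\<Prod>z\<leftarrow>replicate m y. (1 + fps_const z * fps_X) / (1 - fps_const z * fps_X))"
proof (induction m)
  case (Suc m)
  have "(1 + fps_const y * fps_X) / (1 - fps_const y * fps_X) =
    letter_fps y (2 * m) * letter_fps y (Suc (2 * m))"
    by (subst fps_divide_unit) (auto simp: letter_fps_def mult.commute)
  then show ?case using Suc by (simp add: alphabet_fps_def mult.assoc mult.left_commute)
qed (simp add: alphabet_fps_def)

text \<open>At the code \<open>2 * m * length lam\<close> all letters have passed all rows. Every
  row then has the same alphabet, and the mixed determinant becomes the one that defines
  \<open>S_fun\<close>.\<close>

lemma S_fun_eq_label_count:
  assumes "is_partition lam" "lam \<noteq> []"
  shows "S_fun lam (replicate m y) = y ^ sum_list lam * real (label_count m lam)"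
proof -
  have l: "0 < length lam" using assms(2) by simp
  have "row_fps y (length lam) (2 * m * length lam) r = alphabet_fps y (2 * m)" if "r < length lam" for r
    using that l by (simp add: row_fps_def)
  then have "S_fun lam (replicate m y) =
    code_det y (length lam) (2 * m * length lam) (\<lambda>r. int (row_size lam r))"
    unfolding S_fun_def code_det_def
    by (intro arg_cong [of _ _ Determinant.det] eq_matI)
      (auto simp: q_fun_def coef_def alphabet_fps_double row_size_def)
  also have "\<dots> = y ^ sum_list lam * real (label_count m lam)"
    using code_det_eq_card [OF l antimono_row_size [OF assms(1)], of y "2 * m * length lam"]
    by (simp only: sum_row_size card_code_words [OF assms(2)]) (simp add: row_size_def)
  finally show ?thesis .
qed

lemma prob_shelf_shuffle:
  assumes "m \<ge> 1"
  shows "measure_pmf.prob (shelf_shuffle m n) A =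
    real (card {lab \<in> labelings m n. shelf_perm m n lab \<in> A}) / (2 * real m) ^ n"
proof -
  let ?L = "labelings m n"
  have fin: "finite ?L" by (rule finite_PiE_dflt) auto
  have card: "card ?L = (2 * m) ^ n" by (subst card_PiE_dflt) auto
  then have ne: "?L \<noteq> {}" using assms by (metis card.empty mult_eq_0_iff not_one_le_zero power_not_zero zero_neq_numeral)
  have "Pi_pmf {1..n} 0 (\<lambda>_. pmf_of_set {1..2 * m}) = pmf_of_set ?L"
    using assms by (intro Pi_pmf_of_set) auto
  then have "measure_pmf.prob (shelf_shuffle m n) A =
    real (card (?L \<inter> shelf_perm m n -` A)) / real (card ?L)"
    unfolding shelf_shuffle_def measure_map_pmf using measure_pmf_of_set [OF ne fin] by (simp only:)
  also have "?L \<inter> shelf_perm m n -` A = {lab \<in> ?L. shelf_perm m n lab \<in> A}" by auto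
  finally show ?thesis unfolding card by simp
qed

theorem theorem3p10:
  fixes n m :: nat and lam :: "nat list"
  assumes "n \<ge> 1" and "m \<ge> 1"
    and "is_partition lam" and "sum_list lam = n"
  shows "(\<forall>T \<in> SYT lam.
            measure_pmf.prob (shelf_shuffle m n)
              {w. recording_tableau n (inv_into UNIV w) = T}
            = 1 / 2 ^ n * S_fun lam (replicate m (1 / real m)))
       \<and> measure_pmf.prob (shelf_shuffle m n) {w. rsk_shape n w = lam}
         = real (f_SYT lam) / 2 ^ n * S_fun lam (replicate m (1 / real m))"
proof -
  have "lam \<noteq> []" using assms(1,4) by auto
  \<comment> \<open>Homogeneity of degree \<open>n\<close> turns the \<open>m\<close>-part of the
    number \<open>(2 m)^n\<close> of labelings into the value \<open>1 / m\<close> of the variables;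
    \<open>1 / 2^n\<close> remains.\<close>
  then have S: "real (label_count m lam) / (2 * real m) ^ n = 1 / 2 ^ n * S_fun lam (replicate m (1 / real m))"
    using S_fun_eq_label_count [OF assms(3), of m "1 / real m"] assms(4)
    by (simp add: power_mult_distrib power_one_over)
  show ?thesis
  proof (intro conjI ballI)
    fix T assume "T \<in> SYT lam"
    then show "measure_pmf.prob (shelf_shuffle m n) {w. recording_tableau n (inv_into UNIV w) = T}
      = 1 / 2 ^ n * S_fun lam (replicate m (1 / real m))"
      using card_labelings_recording_tableau [OF assms(3,4), of T m]
      unfolding prob_shelf_shuffle [OF assms(2)] S [symmetric] mem_Collect_eq by simp
  next
    show "measure_pmf.prob (shelf_shuffle m n) {w. rsk_shape n w = lam}
      = real (f_SYT lam) / 2 ^ n * S_fun lam (replicate m (1 / real m))"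
      using card_labelings_rsk_shape [OF assms(3,4), of m] arg_cong [OF S, of "(*) (real (f_SYT lam))"]
      by (simp add: prob_shelf_shuffle [OF assms(2)])
  qed
qed

end
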